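(* Let $G$ be a unicyclic graph of order $n$ with girth $g$. Then there exist nonnegative integers $a_1,b_1,b_2,\dots,b_g$ with $b_j\le 1$ for $j=2,\dots,g$ such that the graph $\widetilde G=U(T^*_{a_1,b_1},T^*_{0,b_2},\dots,T^*_{0,b_g})$ (a unicyclic graph of order $n$ with girth $g$) has the same matching number as $G$ and $$W(G)\ge W(\widetilde G),$$ with equality if and only if $G$ is (isomorphic to) $U(T^*_{a_1,b_1},T^*_{0,b_2},\dots,T^*_{0,b_g})$.
   Context: All graphs are finite, simple, undirected. $W(G)=\sum_{\{u,v\}\subseteq V(G)} d_G(u,v)$ is the Wiener index, $d_G$ the distance. A unicyclic graph is a connected graph with exactly one cycle; its girth is the cycle length. The matching number is the maximum size of a matching. If $C_g=u_1u_2\cdots u_g$ is the cycle of a unicyclic graph $G$, then $G-E(C_g)$ consists of $g$ trees $T_1,\dots,T_g$ with $u_i\in V(T_i)$ (the branch at $u_i$, viewed as rooted at $u_i$); we write $G=U(T_1,\dots,T_g)$. Conversely, given a cycle $u_1\cdots u_g$ and vertex-disjoint rooted trees $T_i$, $U(T_1,\dots,T_g)$ denotes the graph obtained by identifying $u_i$ with the root of $T_i$. For nonnegative integers $a,b$, $T^*_{a,b}$ is the rooted tree of order $2a+b+1$ obtained from the star $K_{1,a+b}$ with root its center by attaching one new pendant vertex to each of $a$ of its leaves; $T^*_{0,0}$ is a single vertex and $T^*_{0,1}$ is a single edge rooted at one end. *)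

theory Defs
  imports "Graph_Theory.Graph_Theory"
begin

text \<open>
  A finite simple undirected graph is a \<^locale>\<open>pair_graph\<close>: an undirected edge
  \<open>{u, v}\<close> is the pair of arcs \<open>(u, v)\<close>, \<open>(v, u)\<close>.
\<close>

section \<open>Distance and Wiener index\<close>

definition graph_dist :: "'a pair_pre_digraph \<Rightarrow> 'a \<Rightarrow> 'a \<Rightarrow> nat" where
  "graph_dist G u v = (LEAST k. \<exists>p. pre_digraph.awalk (with_proj G) u p v \<and> length p = k)"

text \<open>
  The sum ranges over the unordered pairs of distinct vertices; the description operator
  picks the distance between the two elements of the pair, which is well defined by symmetry.
\<close>

definition wiener_index :: "'a pair_pre_digraph \<Rightarrow> nat" where
  "wiener_index G =
    (\<Sum>e \<in> {e. e \<subseteq> pverts G \<and> card e = 2}. THE d. \<exists>u v. e = {u, v} \<and> d = graph_dist G u v)"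

section \<open>Unicyclic graphs and girth\<close>

text \<open>
  In the symmetric digraph \<open>G\<close>, an edge traversed back and forth is a directed cycle of length 2;
  the cycles of the undirected graph are the directed cycles of length at least 3.
\<close>

definition graph_cycle :: "'a pair_pre_digraph \<Rightarrow> ('a \<times> 'a) list \<Rightarrow> bool" where
  "graph_cycle G p \<longleftrightarrow> pre_digraph.cycle (with_proj G) p \<and> 3 \<le> length p"

text \<open>
  The same cycle is traversed by several closed walks (choice of starting point and of direction).
  As a subgraph it is determined by its set of edges, represented by the symmetric closure of the
  arcs traversed, and this is what is counted.
\<close>

definition cycle_subgraphs :: "'a pair_pre_digraph \<Rightarrow> ('a \<times> 'a) set set" where
  "cycle_subgraphs G = {symcl (set p) | p. graph_cycle G p}"

definition unicyclic :: "'a pair_pre_digraph \<Rightarrow> bool" where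
  "unicyclic G \<longleftrightarrow>
    pair_graph G \<and> Digraph_Component.connected (with_proj G) \<and> (\<exists>!C. C \<in> cycle_subgraphs G)"

text \<open>
  The length of a shortest cycle; in a unicyclic graph, the length of its only cycle.
\<close>

definition girth :: "'a pair_pre_digraph \<Rightarrow> nat" where
  "girth G = (LEAST k. \<exists>p. graph_cycle G p \<and> length p = k)"

section \<open>Matching number\<close>

definition graph_edges :: "'a pair_pre_digraph \<Rightarrow> 'a set set" where
  "graph_edges G = {{u, v} | u v. (u, v) \<in> parcs G}"

definition matching :: "'a pair_pre_digraph \<Rightarrow> 'a set set \<Rightarrow> bool" where
  "matching G M \<longleftrightarrow> M \<subseteq> graph_edges G \<and> (\<forall>e\<in>M. \<forall>f\<in>M. e \<noteq> f \<longrightarrow> e \<inter> f = {})"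

definition matching_number :: "'a pair_pre_digraph \<Rightarrow> nat" where
  "matching_number G = Max (card ` {M. matching G M})"

section \<open>The graphs \<open>U(T\<^sub>1, \<dots>, T\<^sub>g)\<close>\<close>

type_synonym 'a rooted_graph = "'a pair_pre_digraph \<times> 'a"

text \<open>
  The root is \<open>0\<close>, the leaves of the star are \<open>1, \<dots>, a + b\<close>, and the new pendant vertex
  attached to the leaf \<open>i \<le> a\<close> is \<open>a + b + i\<close>.
\<close>

definition T_star :: "nat \<Rightarrow> nat \<Rightarrow> nat rooted_graph" where
  "T_star a b =
    (\<lparr> pverts = {0..2 * a + b},
       parcs = symcl ({(0, i) | i. 1 \<le> i \<and> i \<le> a + b} \<union> {(i, a + b + i) | i. 1 \<le> i \<and> i \<le> a}) \<rparr>,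
     0)"

text \<open>
  \<open>U_graph [T\<^sub>1, \<dots>, T\<^sub>g]\<close>, meant for \<open>g \<ge> 3\<close>: the trees are made vertex-disjoint by tagging their
  vertices with the (0-based) position in the list, and the roots, being identified with the
  vertices of the cycle, are joined cyclically.
\<close>

definition U_graph :: "'a rooted_graph list \<Rightarrow> (nat \<times> 'a) pair_pre_digraph" where
  "U_graph Ts =
    \<lparr> pverts = {(i, v) | i v. i < length Ts \<and> v \<in> pverts (fst (Ts ! i))},
      parcs =
        {((i, u), (i, v)) | i u v. i < length Ts \<and> (u, v) \<in> parcs (fst (Ts ! i))} \<union>
        symcl {((i, snd (Ts ! i)), (j, snd (Ts ! j))) | i j.
                 i < length Ts \<and> j = Suc i mod length Ts} \<rparr>"

end

theory Submission
  imports Defs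
begin

text \<open>
  Counting, for each edge of a branch, the pairs of vertices that it separates gives
  \<open>2 W(G) = 2 \<Sum> s (n - s) + \<Sum> t\<^sub>i t\<^sub>j d(i, j)\<close>. The first sum ranges over the edges off the cycle,
  \<open>s\<close> being the number of vertices beyond the edge; the second is a quadratic form in the orders
  \<open>t\<^sub>i\<close> of the branches. Pendant edges contribute \<open>n - 1\<close> to the first sum, all others at least
  \<open>2 (n - 2)\<close>, with equality only for \<open>s = 2\<close>. Hence \<open>W(G)\<close> is at least the Wiener index of a graph
  with the same branch orders whose branches are trees \<open>T\<^sup>*\<close>. The paths of length 2 can be
  chosen so that the matching number is kept, because turning one of them into two pendant edges
  changes it by at most 1. If two branches have order at least 3, moving a pendant path or a pendant
  edge towards the branch of smaller transmission decreases the quadratic form; it keeps the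
  matching number unless the new pendant edge can be matched, and then splitting a path of length 2
  at that branch is an improvement instead. So only one large branch remains.
\<close>

section \<open>Distances\<close>

text \<open>The matching number has to be kept exactly while \<open>W\<close> goes down. Graphs are
  therefore compared through configurations \<open>(t, a)\<close>, branch orders and numbers of
  paths of length 2, for which both quantities are explicit. Such a path contributes
  \<open>2 * (n - 2) + (n - 1)\<close> to the sum over edges, two pendant edges contribute
  \<open>2 * (n - 1)\<close>; so every path costs \<open>n - 3\<close> extra and fewer paths are
  cheaper. In a maximum matching the outer edge of each path may be assumed to be chosen; what
  remains is the cycle with at most one useful pendant edge per vertex. Hence the matching number
  depends only on the number of paths and on the set of roots that carry a pendant edge. The
  equality case is settled without comparing parameters. Either \<open>G\<close> has the extremal
  shape and is its own comparison graph up to isomorphism, or some step of the comparison is strict,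
  and a graph of smaller Wiener index is not isomorphic to \<open>G\<close>.\<close>

lemma (in pair_wf_digraph) ex_awalk_iff_relpow:
  assumes "x \<in> pverts G"
  shows "(\<exists>p. awalk x p y \<and> length p = k) \<longleftrightarrow> (x, y) \<in> parcs G ^^ k"
  using assms
proof (induction k arbitrary: x)
  case 0
  then show ?case by (auto simp: awalk_Nil_iff)
next
  case (Suc k)
  show ?case
  proof
    assume "\<exists>p. awalk x p y \<and> length p = Suc k"
    then obtain e p where p: "awalk x (e # p) y" "length p = k"
      by (auto simp: length_Suc_conv)
    then have e: "e \<in> parcs G" "fst e = x" "snd e \<in> pverts G" and "awalk (snd e) p y"
      by (auto simp: awalk_Cons_iff intro: arc_snd_in_verts)
    then have "(snd e, y) \<in> parcs G ^^ k"
      using Suc.IH p(2) by blast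
    with e show "(x, y) \<in> parcs G ^^ Suc k"
      by (metis prod.collapse relpow_Suc_I2)
  next
    assume "(x, y) \<in> parcs G ^^ Suc k"
    then obtain z where z: "(x, z) \<in> parcs G" "(z, y) \<in> parcs G ^^ k"
      by (metis relpow_Suc_D2)
    then obtain p where "awalk z p y" "length p = k"
      using Suc.IH[of z] by (meson in_arcsD2)
    then have "awalk x ((x, z) # p) y" "length ((x, z) # p) = Suc k"
      using z(1) Suc.prems by (auto simp: awalk_Cons_iff)
    then show "\<exists>p. awalk x p y \<and> length p = Suc k" by blast
  qed
qed

text \<open>Powers of the arc relation replace walks, so that bounds and invariance of distances
  become inductions over a relation instead of over lists of arcs.\<close>

lemma (in pair_wf_digraph) graph_dist_eq_Least_relpow:
  assumes "x \<in> pverts G"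
  shows "graph_dist G x y = (LEAST k. (x, y) \<in> parcs G ^^ k)"
  using ex_awalk_iff_relpow[OF assms] by (simp add: graph_dist_def)

lemma relpow_potential:
  fixes \<phi> :: "'a \<Rightarrow> nat"
  assumes "\<And>y z. (y, z) \<in> R \<Longrightarrow> \<phi> z \<le> Suc (\<phi> y)"
  shows "(x, y) \<in> R ^^ k \<Longrightarrow> \<phi> y \<le> \<phi> x + k"
proof (induction k arbitrary: y)
  case (Suc k)
  then obtain z where "(x, z) \<in> R ^^ k" "(z, y) \<in> R" by auto
  then show ?case using Suc.IH[of z] assms[of z y] by simp
qed simp

text \<open>Breadth-first search certificate: a 1-Lipschitz function that has a strictly smaller value
  at some neighbour of each vertex other than the source is the distance from the source.\<close>

lemma (in pair_graph)
  fixes \<phi> :: "'a \<Rightarrow> nat"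
  assumes lip: "\<And>y z. (y, z) \<in> parcs G \<Longrightarrow> \<phi> z \<le> Suc (\<phi> y)"
    and dec: "\<And>y. y \<in> pverts G \<Longrightarrow> y \<noteq> x \<Longrightarrow> \<exists>z. (y, z) \<in> parcs G \<and> \<phi> z < \<phi> y"
    and x: "x \<in> pverts G" "\<phi> x = 0" and y: "y \<in> pverts G"
  shows graph_dist_eqI: "graph_dist G x y = \<phi> y"
    and relpow_distI: "(x, y) \<in> parcs G ^^ \<phi> y"
proof -
  show reach: "(x, y) \<in> parcs G ^^ \<phi> y"
    using y
  proof (induction "\<phi> y" arbitrary: y rule: less_induct)
    case less
    show ?case
    proof (cases "y = x")
      case False
      then obtain z where z: "(y, z) \<in> parcs G" "\<phi> z < \<phi> y"
        using dec less.prems by blast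
      then have zy: "(z, y) \<in> parcs G" and "z \<in> pverts G"
        by (auto intro: arcs_symmetric in_arcsD2)
      then have "(x, z) \<in> parcs G ^^ \<phi> z" and "\<phi> y = Suc (\<phi> z)"
        using less.hyps[OF z(2)] lip[OF zy] z(2) by auto
      then show ?thesis using zy by auto
    qed (use x in simp)
  qed
  have "\<phi> y \<le> k" if "(x, y) \<in> parcs G ^^ k" for k
    using relpow_potential[of "parcs G" \<phi>, OF lip that] x(2) by simp
  with reach show "graph_dist G x y = \<phi> y"
    unfolding graph_dist_eq_Least_relpow[OF x(1)] by (intro Least_equality)
qed

lemma (in pair_sym_digraph) relpow_arcs_commute:
  "(x, y) \<in> parcs G ^^ k \<Longrightarrow> (y, x) \<in> parcs G ^^ k"
proof (induction k arbitrary: x)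
  case (Suc k)
  then obtain z where "(x, z) \<in> parcs G" "(z, y) \<in> parcs G ^^ k"
    by (metis relpow_Suc_D2)
  then show ?case using Suc.IH arcs_symmetric by (meson relpow_Suc_I)
qed simp

lemma (in pair_sym_digraph) graph_dist_commute:
  assumes "x \<in> pverts G" "y \<in> pverts G"
  shows "graph_dist G x y = graph_dist G y x"
proof -
  have "(\<lambda>k. (x, y) \<in> parcs G ^^ k) = (\<lambda>k. (y, x) \<in> parcs G ^^ k)"
    using relpow_arcs_commute by blast
  then show ?thesis using assms by (simp add: graph_dist_eq_Least_relpow)
qed

lemma (in pair_wf_digraph) graph_dist_self:
  "x \<in> pverts G \<Longrightarrow> graph_dist G x x = 0"
  by (auto simp: graph_dist_eq_Least_relpow intro: Least_equality)

text \<open>A two-element set is the image of exactly two ordered pairs, and the diagonal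
  contributes zero. Later estimates concern this ordered sum, whence their factors 2.\<close>

lemma (in pair_graph) double_wiener_index:
  "2 * wiener_index G = (\<Sum>x\<in>pverts G. \<Sum>y\<in>pverts G. graph_dist G x y)"
proof -
  let ?V = "pverts G" and ?d = "graph_dist G"
  let ?E = "{e. e \<subseteq> ?V \<and> card e = 2}"
  let ?P = "{(x, y) \<in> ?V \<times> ?V. x \<noteq> y}"
  let ?w = "\<lambda>e. THE d. \<exists>u v. e = {u, v} \<and> d = ?d u v"
  have w: "?w {x, y} = ?d x y" if "x \<in> ?V" "y \<in> ?V" for x y
    using that graph_dist_commute[OF that]
    by (intro the_equality) (auto simp: doubleton_eq_iff)
  have fin: "finite ?V" "finite ?P"
    using pair_finite_verts by (auto intro: finite_subset[of _ "?V \<times> ?V"])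
  have "(\<Sum>x\<in>?V. \<Sum>y\<in>?V. ?d x y) = (\<Sum>(x, y)\<in>?V \<times> ?V. ?d x y)"
    by (simp add: sum.cartesian_product)
  also have "\<dots> = (\<Sum>(x, y)\<in>?P. ?d x y)"
    by (rule sum.mono_neutral_right) (use fin in \<open>auto simp: graph_dist_self\<close>)
  also have "\<dots> = (\<Sum>e\<in>?E. \<Sum>(x, y)\<in>{q \<in> ?P. {fst q, snd q} = e}. ?d x y)"
    by (rule sum.group[symmetric])
       (use fin in \<open>auto simp: card_insert_if intro: finite_subset[of _ "Pow ?V"]\<close>)
  also have "\<dots> = (\<Sum>e\<in>?E. 2 * ?w e)"
  proof (rule sum.cong[OF refl])
    fix e assume "e \<in> ?E"
    then obtain x y where e: "e = {x, y}" "x \<noteq> y" and xy: "x \<in> ?V" "y \<in> ?V"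
      by (auto simp: card_2_iff)
    then have "{q \<in> ?P. {fst q, snd q} = e} = {(x, y), (y, x)}"
      by (auto simp: doubleton_eq_iff)
    then show "(\<Sum>(x, y)\<in>{q \<in> ?P. {fst q, snd q} = e}. ?d x y) = 2 * ?w e"
      using e xy w graph_dist_commute[OF xy] by simp
  qed
  finally show ?thesis by (simp add: wiener_index_def sum_distrib_left)
qed

section \<open>Isomorphisms of graphs given by pairs\<close>

definition pair_iso :: "('a \<Rightarrow> 'b) \<Rightarrow> 'a pair_pre_digraph \<Rightarrow> 'b pair_pre_digraph \<Rightarrow> bool" where
  "pair_iso h G H \<longleftrightarrow>
    inj_on h (pverts G) \<and> pverts H = h ` pverts G \<and> parcs H = map_prod h h ` parcs G"

text \<open>Since arcs are pairs of vertices and the head and tail maps of both graphs are the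
  projections, the arc map of an isomorphism is forced by its vertex map.\<close>

lemma (in pair_wf_digraph) digraph_iso_with_proj_iff:
  "digraph_iso (with_proj G) (with_proj H) \<longleftrightarrow> (\<exists>h. pair_iso h G H)"
proof
  assume "digraph_iso (with_proj G) (with_proj H)"
  then obtain f where f: "digraph_isomorphism f" and H: "with_proj H = app_iso f (with_proj G)"
    unfolding digraph_iso_def by blast
  let ?h = "iso_verts f"
  have V: "pverts H = ?h ` pverts G" and A: "parcs H = iso_arcs f ` parcs G"
    and tl: "iso_tail f = fst" and hd: "iso_head f = snd"
    using arg_cong[OF H, of verts] arg_cong[OF H, of arcs]
      arg_cong[OF H, of tail] arg_cong[OF H, of head] by auto
  have "iso_arcs f a = map_prod ?h ?h a" if "a \<in> parcs G" for a
    using f that tl hd unfolding digraph_isomorphism_def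
    by (simp add: prod_eq_iff)
  then have "parcs H = map_prod ?h ?h ` parcs G" using A by (auto simp: image_iff)
  with V f show "\<exists>h. pair_iso h G H"
    unfolding digraph_isomorphism_def pair_iso_def by auto
next
  assume "\<exists>h. pair_iso h G H"
  then obtain h where h: "inj_on h (pverts G)" "pverts H = h ` pverts G"
    "parcs H = map_prod h h ` parcs G"
    by (auto simp: pair_iso_def)
  let ?f = "\<lparr>iso_verts = h, iso_arcs = map_prod h h, iso_head = snd, iso_tail = fst\<rparr>"
  have "inj_on (map_prod h h) (parcs G)"
    by (rule inj_on_subset[OF map_prod_inj_on[OF h(1) h(1)]]) (auto dest: in_arcsD1 in_arcsD2)
  then have "digraph_isomorphism ?f"
    using h(1) unfolding digraph_isomorphism_def by (auto intro: wf_digraph_axioms)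
  moreover have "with_proj H = app_iso ?f (with_proj G)"
    using h by (simp add: with_proj_def app_iso_def)
  ultimately show "digraph_iso (with_proj G) (with_proj H)"
    unfolding digraph_iso_def by blast
qed

lemma (in pair_wf_digraph) pair_iso_relpow_iff:
  assumes "pair_iso h G H" "x \<in> pverts G" "y \<in> pverts G"
  shows "(h x, h y) \<in> parcs H ^^ k \<longleftrightarrow> (x, y) \<in> parcs G ^^ k"
  using assms(3)
proof (induction k arbitrary: y)
  case 0
  then show ?case using assms(1,2) by (auto simp: pair_iso_def dest: inj_onD)
next
  case (Suc k)
  have arc: "(h z, h y) \<in> parcs H \<longleftrightarrow> (z, y) \<in> parcs G" if "z \<in> pverts G" for z
  proof
    assume "(h z, h y) \<in> parcs H"
    then obtain a b where ab: "(a, b) \<in> parcs G" "h z = h a" "h y = h b"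
      using assms(1) by (auto simp: pair_iso_def)
    then have "z = a" "y = b"
      using assms(1) that Suc.prems by (auto simp: pair_iso_def dest: inj_onD in_arcsD1 in_arcsD2)
    with ab show "(z, y) \<in> parcs G" by simp
  qed (use assms(1) in \<open>auto simp: pair_iso_def\<close>)
  show ?case
  proof
    assume "(h x, h y) \<in> parcs H ^^ Suc k"
    then obtain w where w: "(h x, w) \<in> parcs H ^^ k" "(w, h y) \<in> parcs H" by auto
    then obtain z where "z \<in> pverts G" "w = h z"
      using assms(1) by (auto simp: pair_iso_def dest: in_arcsD1)
    with w arc Suc.IH show "(x, y) \<in> parcs G ^^ Suc k" by auto
  next
    assume "(x, y) \<in> parcs G ^^ Suc k"
    then obtain z where "(x, z) \<in> parcs G ^^ k" "(z, y) \<in> parcs G" by auto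
    moreover from this have "z \<in> pverts G" by (simp add: in_arcsD1)
    ultimately show "(h x, h y) \<in> parcs H ^^ Suc k" using arc Suc.IH by auto
  qed
qed

lemma wiener_index_pair_iso:
  assumes "pair_graph G" "pair_graph H" "pair_iso h G H"
  shows "wiener_index H = wiener_index G"
proof -
  interpret G: pair_graph G by fact
  interpret H: pair_graph H by fact
  have h: "inj_on h (pverts G)" "pverts H = h ` pverts G"
    using assms(3) by (auto simp: pair_iso_def)
  have "graph_dist H (h x) (h y) = graph_dist G x y" if "x \<in> pverts G" "y \<in> pverts G" for x y
    using that h(2)
    by (simp add: G.graph_dist_eq_Least_relpow H.graph_dist_eq_Least_relpow
        G.pair_iso_relpow_iff[OF assms(3)])
  then have "2 * wiener_index H = 2 * wiener_index G"
    unfolding G.double_wiener_index H.double_wiener_index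
    by (simp add: h sum.reindex)
  then show ?thesis by simp
qed

lemma matching_number_pair_iso:
  assumes "pair_graph G" "pair_iso h G H"
  shows "matching_number H = matching_number G"
proof -
  interpret G: pair_graph G by fact
  have h: "inj_on h (pverts G)" "parcs H = map_prod h h ` parcs G"
    using assms(2) by (auto simp: pair_iso_def)
  have E: "graph_edges G \<subseteq> Pow (pverts G)"
    by (auto simp: graph_edges_def dest: G.in_arcsD1 G.in_arcsD2)
  have inj: "inj_on (image h) (Pow (pverts G))"
    using h(1) by (rule inj_on_image_Pow)
  have EH: "graph_edges H = image h ` graph_edges G"
  proof (intro subset_antisym subsetI)
    fix e assume "e \<in> graph_edges H"
    then obtain u v where "(u, v) \<in> parcs G" "e = {h u, h v}"
      by (auto simp: graph_edges_def h(2))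
    then show "e \<in> image h ` graph_edges G"
      by (intro image_eqI[of _ _ "{u, v}"]) (auto simp: graph_edges_def)
  qed (auto simp: graph_edges_def h(2))
  have M: "matching H (image h ` M) \<longleftrightarrow> matching G M" if "M \<subseteq> graph_edges G" for M
  proof -
    have "h ` e \<inter> h ` f = h ` (e \<inter> f)" "h ` e = h ` f \<longleftrightarrow> e = f" if "e \<in> M" "f \<in> M" for e f
      using that \<open>M \<subseteq> graph_edges G\<close> E h(1) inj_on_image_Int[of h "pverts G" e f]
        inj_on_eq_iff[OF inj, of e f] by blast+
    note * = this
    have "image h ` M \<subseteq> graph_edges H" using that EH by blast
    moreover have "(\<forall>e\<in>M. \<forall>f\<in>M. h ` e \<noteq> h ` f \<longrightarrow> h ` e \<inter> h ` f = {}) \<longleftrightarrow>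
      (\<forall>e\<in>M. \<forall>f\<in>M. e \<noteq> f \<longrightarrow> e \<inter> f = {})"
      using * by (metis image_is_empty)
    ultimately show ?thesis
      using that unfolding matching_def by simp
  qed
  have "{M. matching H M} = image (image h) ` {M. matching G M}"
  proof (intro subset_antisym subsetI)
    fix M assume "M \<in> {M. matching H M}"
    then have "M \<subseteq> image h ` graph_edges G" "matching H M" by (auto simp: matching_def EH)
    then obtain N where "N \<subseteq> graph_edges G" "M = image h ` N" by (meson subset_imageE)
    then show "M \<in> image (image h) ` {M. matching G M}" using M \<open>matching H M\<close> by auto
  next
    fix M assume "M \<in> image (image h) ` {M. matching G M}"
    then obtain N where "matching G N" "M = image h ` N" by auto
    then show "M \<in> {M. matching H M}" using M[of N] by (simp add: matching_def)
  qed
  moreover have "card (image h ` M) = card M" if "matching G M" for M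
    using that inj_on_subset[OF inj, of M] E by (auto simp: matching_def intro: card_image)
  ultimately have "card ` {M. matching H M} = card ` {M. matching G M}"
    by (auto simp: image_iff)
  then show ?thesis by (simp add: matching_number_def)
qed

section \<open>Cycles\<close>

lemma all_nat_split: "(\<forall>i::nat. P i) \<longleftrightarrow> P 0 \<and> (\<forall>i. P (Suc i))"
  using nat.exhaust by metis

text \<open>Cycles are handled by indices modulo their length; this turns the recursive chaining
  condition into one on consecutive positions.\<close>

lemma pcas_iff_nth:
  "pcas u p v \<longleftrightarrow> (if p = [] then u = v else fst (hd p) = u \<and> snd (last p) = v \<and>
    (\<forall>i. Suc i < length p \<longrightarrow> snd (p ! i) = fst (p ! Suc i)))"
proof (induction p arbitrary: u)
  case (Cons e p)
  show ?case
  proof (cases p)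
    case (Cons e' p')
    have "(\<forall>i. Suc i < length (e # p) \<longrightarrow> snd ((e # p) ! i) = fst ((e # p) ! Suc i)) \<longleftrightarrow>
      snd e = fst e' \<and> (\<forall>i. Suc i < length p \<longrightarrow> snd (p ! i) = fst (p ! Suc i))"
      (is "(\<forall>i. ?P i) \<longleftrightarrow> _")
    proof -
      have "(\<forall>i. ?P i) \<longleftrightarrow> ?P 0 \<and> (\<forall>i. ?P (Suc i))"
        by (rule all_nat_split)
      then show ?thesis using Cons by simp
    qed
    moreover have "pcas u (e # p) v \<longleftrightarrow> fst e = u \<and> fst e' = snd e \<and> snd (last p) = v \<and>
        (\<forall>i. Suc i < length p \<longrightarrow> snd (p ! i) = fst (p ! Suc i))"
      using Cons.IH[of "snd e"] Cons by simp
    ultimately show ?thesis using Cons by (simp only: list.sel last.simps list.distinct if_False) metis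
  qed auto
qed simp

text \<open>\<open>cycle\<close> asks for distinct vertices after the first one, that is, for
  distinct heads of the arcs. In a closed walk the heads are the tails shifted cyclically by one, so
  the tails \<open>c i\<close> are distinct as well.\<close>

lemma (in pair_graph) graph_cycleE:
  assumes "graph_cycle G p"
  obtains c where "inj_on c {..<length p}" "3 \<le> length p"
    "p = map (\<lambda>i. (c i, c (Suc i mod length p))) [0..<length p]"
    "\<And>i. i < length p \<Longrightarrow> (c i, c (Suc i mod length p)) \<in> parcs G"
proof -
  let ?n = "length p"
  from assms obtain u where n: "3 \<le> ?n" and w: "awalk u p u" and d: "distinct (tl (awalk_verts u p))"
    by (auto simp: graph_cycle_def cycle_def)
  then have p: "p \<noteq> []" "set p \<subseteq> parcs G" "pcas u p u" by (auto simp: awalk_def)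
  define c where "c i = fst (p ! i)" for i
  have snd: "snd (p ! i) = c (Suc i mod ?n)" if "i < ?n" for i
  proof (cases "Suc i = ?n")
    case True
    then show ?thesis using p(1,3)
      by (auto simp: pcas_iff_nth c_def hd_conv_nth last_conv_nth simp flip: True)
  next
    case False
    then show ?thesis using p(1,3) that by (auto simp: pcas_iff_nth c_def)
  qed
  have "distinct (map snd p)"
    using d p(1) by (simp add: awalk_verts_conv'[OF p(3)])
  then have snd_inj: "i = j" if "i < ?n" "j < ?n" "snd (p ! i) = snd (p ! j)" for i j
    using that by (metis distinct_conv_nth length_map nth_map)
  have "inj_on c {..<?n}"
  proof (rule inj_onI)
    fix i j assume ij: "i \<in> {..<?n}" "j \<in> {..<?n}" "c i = c j"
    have pred: "\<exists>k<?n. Suc k mod ?n = l" if "l < ?n" for l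
      using that n by (cases l) (auto intro: exI[of _ "?n - 1"] exI[of _ "l - 1"])
    then obtain k l where "k < ?n" "Suc k mod ?n = i" "l < ?n" "Suc l mod ?n = j"
      using ij by (meson lessThan_iff)
    with ij(3) snd_inj[of k l] show "i = j" by (simp add: snd)
  qed
  moreover have "p = map (\<lambda>i. (c i, c (Suc i mod ?n))) [0..<?n]"
    by (intro nth_equalityI) (simp_all add: prod_eq_iff snd, simp_all add: c_def)
  moreover have "(c i, c (Suc i mod ?n)) \<in> parcs G" if "i < ?n" for i
    using that p(2) snd[OF that] by (metis c_def nth_mem prod.collapse subsetD)
  ultimately show thesis using that n by blast
qed

lemma (in pair_graph) graph_cycleI:
  assumes "inj_on c {..<n}" "3 \<le> n" "\<And>i. i < n \<Longrightarrow> (c i, c (Suc i mod n)) \<in> parcs G"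
  shows "graph_cycle G (map (\<lambda>i. (c i, c (Suc i mod n))) [0..<n])"
proof -
  let ?p = "map (\<lambda>i. (c i, c (Suc i mod n))) [0..<n]"
  have p: "?p \<noteq> []" "set ?p \<subseteq> parcs G" using assms by auto
  have cas: "pcas (c 0) ?p (c 0)"
    using assms(2) by (auto simp: pcas_iff_nth hd_map last_map)
  have "c 0 \<in> pverts G" using assms(2,3) in_arcsD1 by fastforce
  then have w: "awalk (c 0) ?p (c 0)" using p cas by (simp add: awalk_def)
  have inj: "inj_on (\<lambda>i. Suc i mod n) {..<n}"
  proof (rule inj_onI)
    fix i j assume "i \<in> {..<n}" "j \<in> {..<n}" "Suc i mod n = Suc j mod n"
    then show "i = j"
      by (cases "Suc i = n"; cases "Suc j = n") auto
  qed
  have "(\<lambda>i. Suc i mod n) ` {..<n} \<subseteq> {..<n}" using assms(2) by auto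
  then have "inj_on (\<lambda>i. c (Suc i mod n)) {..<n}"
    using comp_inj_on[OF inj inj_on_subset[OF assms(1)]] by (simp add: comp_def)
  then have "distinct (map snd ?p)"
    by (simp add: distinct_map comp_def inj_on_def)
  moreover have "tl (awalk_verts (c 0) ?p) = map snd ?p"
    using p(1) by (simp only: awalk_verts_conv'[OF cas] if_False list.sel)
  ultimately have "distinct (tl (awalk_verts (c 0) ?p))" by (simp only:)
  with w p(1) have "cycle ?p" unfolding cycle_def by (intro exI conjI)
  then show ?thesis using assms(2) by (simp add: graph_cycle_def)
qed

section \<open>Unicyclic graphs as functional graphs\<close>

text \<open>A unicyclic graph is the graph of a function \<open>f\<close>: each vertex off the cycle is sent to its
  parent in its branch, each vertex of the cycle to its successor. The edges are then in bijection
  with the vertices.\<close>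

definition fun_graph :: "'a set \<Rightarrow> ('a \<Rightarrow> 'a) \<Rightarrow> 'a pair_pre_digraph" where
  "fun_graph V f = \<lparr>pverts = V, parcs = {(x, y). x \<in> V \<and> y = f x \<or> y \<in> V \<and> x = f y}\<rparr>"

lemma fun_graph_simps [simp]:
  "pverts (fun_graph V f) = V"
  "(x, y) \<in> parcs (fun_graph V f) \<longleftrightarrow> x \<in> V \<and> y = f x \<or> y \<in> V \<and> x = f y"
  by (auto simp: fun_graph_def)

text \<open>Subtraction is truncated, so one of the two differences is 0 and \<open>d\<close> is the
  absolute value of \<open>i - j\<close>; the minimum picks the shorter way around the
  cycle.\<close>

definition cyc_dist :: "nat \<Rightarrow> nat \<Rightarrow> nat \<Rightarrow> nat" where
  "cyc_dist g i j = (let d = (i - j) + (j - i) in min d (g - d))"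

lemma cyc_dist_self [simp]: "cyc_dist g i i = 0"
  by (simp add: cyc_dist_def)

lemma cyc_dist_commute: "cyc_dist g i j = cyc_dist g j i"
  by (simp add: cyc_dist_def add.commute)

lemma Suc_mod_eq: "i < g \<Longrightarrow> Suc i mod g = (if Suc i = g then 0 else Suc i)"
  by auto

lemma cyc_dist_pos: "i < g \<Longrightarrow> j < g \<Longrightarrow> i \<noteq> j \<Longrightarrow> 0 < cyc_dist g i j"
  by (auto simp: cyc_dist_def Let_def)

lemma min_compl_Suc:
  fixes d g :: nat
  shows "min (Suc d) (g - Suc d) \<le> Suc (min d (g - d))"
    and "min d (g - d) \<le> Suc (min (Suc d) (g - Suc d))"
  by linarith+

lemma min_compl_decrease:
  fixes d g :: nat
  assumes "0 < d" "d < g"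
  shows "min (d - 1) (g - (d - 1)) < min d (g - d) \<or> min (Suc d) (g - Suc d) < min d (g - d)"
  using assms by linarith

lemma cyc_dist_le: "i \<le> j \<Longrightarrow> cyc_dist g i j = min (j - i) (g - (j - i))"
  by (simp add: cyc_dist_def Let_def)

lemma cyc_dist_0: "i < g \<Longrightarrow> cyc_dist g i 0 = min (g - i) (g - (g - i))"
  by (simp add: cyc_dist_def Let_def min.commute)

text \<open>The difference of the indices changes by one, except at the wrap-around
  \<open>Suc j = g\<close>. There the new difference \<open>i\<close> is the complement of
  \<open>Suc (j - i)\<close>, which gives the same minimum.\<close>

lemma cyc_dist_Suc_le:
  assumes "i < g" "j < g"
  shows "cyc_dist g i (Suc j mod g) \<le> Suc (cyc_dist g i j)"
    and "cyc_dist g i j \<le> Suc (cyc_dist g i (Suc j mod g))"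
proof -
  have "cyc_dist g i (Suc j mod g) \<le> Suc (cyc_dist g i j) \<and>
    cyc_dist g i j \<le> Suc (cyc_dist g i (Suc j mod g))"
  proof (cases "j < i")
    case True
    then have "Suc j mod g = Suc j" "i - j = Suc (i - Suc j)" using assms by auto
    then show ?thesis
      using True min_compl_Suc[of "i - Suc j" g] by (simp add: cyc_dist_le cyc_dist_commute[of g i])
  next
    case False
    have "cyc_dist g i (Suc j mod g) = min (Suc (j - i)) (g - Suc (j - i))"
    proof (cases "Suc j = g")
      case True
      then have "g - i = Suc (j - i)" using False by auto
      then show ?thesis using True assms(1) by (simp add: cyc_dist_0)
    next
      case not: False
      then have "Suc j mod g = Suc j" "Suc j - i = Suc (j - i)" using assms False by auto
      then show ?thesis using False by (simp add: cyc_dist_le)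
    qed
    then show ?thesis
      using False min_compl_Suc[of "j - i" g] by (simp add: cyc_dist_le)
  qed
  then show "cyc_dist g i (Suc j mod g) \<le> Suc (cyc_dist g i j)"
    "cyc_dist g i j \<le> Suc (cyc_dist g i (Suc j mod g))" by auto
qed

text \<open>The neighbour of \<open>j\<close> on the shorter of the two ways to \<open>i\<close> is
  closer to \<open>i\<close>; it is the successor or the predecessor of \<open>j\<close>.\<close>

lemma cyc_dist_decrease:
  assumes "i < g" "j < g" "i \<noteq> j"
  shows "\<exists>k<g. (k = Suc j mod g \<or> j = Suc k mod g) \<and> cyc_dist g i k < cyc_dist g i j"
proof -
  define p where "p = (if j = 0 then g - 1 else j - 1)"
  have p: "p < g" "j = Suc p mod g" using assms by (auto simp: p_def)
  have s: "Suc j mod g < g" using assms by simp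
  have "cyc_dist g i (Suc j mod g) < cyc_dist g i j \<or> cyc_dist g i p < cyc_dist g i j"
  proof (cases "i < j")
    case True
    then have p_eq: "cyc_dist g i p = min (j - i - 1) (g - (j - i - 1))"
      by (simp add: p_def cyc_dist_le diff_diff_eq add.commute)
    have s_eq: "cyc_dist g i (Suc j mod g) = min (Suc (j - i)) (g - Suc (j - i))"
    proof (cases "Suc j = g")
      case eq: True
      then have "g - i = Suc (j - i)" using True by auto
      then show ?thesis using eq assms(1) by (simp add: cyc_dist_0)
    next
      case False
      then have "Suc j mod g = Suc j" "Suc j - i = Suc (j - i)" using assms True by auto
      then show ?thesis using True by (simp add: cyc_dist_le)
    qed
    have "cyc_dist g i j = min (j - i) (g - (j - i))" "0 < j - i" "j - i < g"
      using True assms by (auto simp: cyc_dist_le)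
    then show ?thesis
      using min_compl_decrease[of "j - i" g] unfolding p_eq s_eq by metis
  next
    case False
    then have ij: "j < i" using assms by simp
    then have "Suc j mod g = Suc j" "i - Suc j = i - j - 1" using assms by auto
    then have s_eq: "cyc_dist g i (Suc j mod g) = min (i - j - 1) (g - (i - j - 1))"
      using ij by (simp add: cyc_dist_le cyc_dist_commute[of g i])
    have p_eq: "cyc_dist g i p = min (Suc (i - j)) (g - Suc (i - j))"
    proof (cases j)
      case 0
      then have "g - 1 - i = g - Suc i" "g - (g - Suc i) = Suc i" using assms by auto
      then show ?thesis using 0 assms by (simp add: p_def cyc_dist_le min.commute)
    next
      case (Suc k)
      then have "i - k = Suc (i - j)" using ij by auto
      then show ?thesis using Suc ij by (simp add: p_def cyc_dist_le cyc_dist_commute[of g i])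
    qed
    have "cyc_dist g i j = min (i - j) (g - (i - j))" "0 < i - j" "i - j < g"
      using ij assms by (auto simp: cyc_dist_le cyc_dist_commute[of g i])
    then show ?thesis
      using min_compl_decrease[of "i - j" g] unfolding p_eq s_eq by metis
  qed
  then show ?thesis using p s by metis
qed

text \<open>The cycle is \<open>u 0, \<dots>, u (g - 1)\<close>, \<open>ix v\<close> is the index of the branch of \<open>v\<close>, and \<open>h\<close> is only
  required to decrease along \<open>f\<close> off the cycle, so that every branch is a tree rooted at \<open>u (ix v)\<close>.\<close>

locale rooted_cycle =
  fixes V :: "'a set" and f :: "'a \<Rightarrow> 'a" and u :: "nat \<Rightarrow> 'a" and g :: nat
    and ix :: "'a \<Rightarrow> nat" and h :: "'a \<Rightarrow> nat"
  assumes fin: "finite V" and g3: "3 \<le> g"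
    and u_in: "i < g \<Longrightarrow> u i \<in> V" and ix_u: "i < g \<Longrightarrow> ix (u i) = i"
    and f_u: "i < g \<Longrightarrow> f (u i) = u (Suc i mod g)"
    and ix_less: "v \<in> V \<Longrightarrow> ix v < g"
    and f_off: "v \<in> V \<Longrightarrow> v \<noteq> u (ix v) \<Longrightarrow> f v \<in> V \<and> ix (f v) = ix v \<and> h (f v) < h v"
begin

abbreviation "G \<equiv> fun_graph V f"

definition "off = {v \<in> V. v \<noteq> u (ix v)}"

text \<open>These stand for the branch edges that are not pendant: \<open>v\<close> has a
  child.\<close>

definition "inner = {v \<in> off. \<exists>w\<in>off. f w = v}"

text \<open>The vertices \<open>v\<close> off the cycle stand for the edges \<open>{v, f v}\<close> of the branches; \<open>anc x\<close> is then
  the edge set of the path from \<open>x\<close> to the cycle, and \<open>below v\<close> the number of vertices that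
  \<open>{v, f v}\<close> separates from the cycle.\<close>

definition "anc x = {v \<in> off. \<exists>k. (f ^^ k) x = v}"

definition "below v = card {x \<in> V. v \<in> anc x}"

definition "bsize i = card {x \<in> V. ix x = i}"

text \<open>For a branch \<open>T_star a b\<close> this is \<open>a\<close>. For any branch it
  bounds the number of matching edges that avoid the root.\<close>

definition "binner i = card {v \<in> inner. ix v = i}"

lemma finite_off: "finite off" and finite_inner: "finite inner"
  using fin by (auto simp: off_def inner_def)

lemma offD: "v \<in> off \<Longrightarrow> v \<in> V" "v \<in> off \<Longrightarrow> f v \<in> V" "v \<in> off \<Longrightarrow> ix (f v) = ix v"
  "v \<in> off \<Longrightarrow> h (f v) < h v" "v \<in> off \<Longrightarrow> ix v < g"
  using f_off ix_less by (auto simp: off_def)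

lemma u_notin_off: "i < g \<Longrightarrow> u i \<notin> off"
  by (simp add: off_def ix_u)

lemma inj_u: "inj_on u {..<g}"
  by (metis inj_onI ix_u lessThan_iff)

lemma Suc_mod_less: "Suc i mod g < g"
  using g3 by simp

lemma V_cases:
  assumes "v \<in> V"
  obtains (cyc) i where "i < g" "v = u i" | (off) "v \<in> off"
  using assms ix_less off_def by blast

lemma V_eq: "V = off \<union> u ` {..<g}"
  using V_cases u_in offD(1) by blast

lemma card_off: "card off + g = card V"
proof -
  have "off \<inter> u ` {..<g} = {}" using u_notin_off by auto
  then show ?thesis
    using card_Un_disjoint[of off "u ` {..<g}"] finite_off card_image[OF inj_u] V_eq by simp
qed

lemma f_in: "v \<in> V \<Longrightarrow> f v \<in> V"
  using offD(2) f_u u_in Suc_mod_less by (metis V_cases)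

lemma f_neq: "v \<in> V \<Longrightarrow> f v \<noteq> v"
proof (erule V_cases)
  fix i assume "i < g" "v = u i"
  moreover have "Suc i mod g \<noteq> i" using \<open>i < g\<close> g3 by (auto simp: Suc_mod_eq)
  ultimately show "f v \<noteq> v" using f_u ix_u Suc_mod_less by metis
next
  assume "v \<in> off"
  then show "f v \<noteq> v" using offD(4)[of v] by auto
qed

text \<open>On the cycle this is \<open>g \<ge> 3\<close>; off the cycle \<open>h\<close> drops, or
  \<open>f v\<close> is on the cycle, which \<open>f\<close> never leaves. It makes
  \<open>{v, f v}\<close> a different edge for each \<open>v\<close>.\<close>

lemma f_f_neq:
  assumes "v \<in> V" shows "f (f v) \<noteq> v"
  using assms
proof (cases rule: V_cases)
  case (cyc i)
  have "Suc (Suc i mod g) mod g \<noteq> i"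
    using cyc g3 by (auto simp: Suc_mod_eq split: if_splits)
  moreover have "f (f v) = u (Suc (Suc i mod g) mod g)"
    using cyc f_u Suc_mod_less by metis
  ultimately show ?thesis using cyc ix_u Suc_mod_less by metis
next
  case off
  then show ?thesis
  proof (cases "f v \<in> off")
    case True
    then show ?thesis using off offD(4)[of v] offD(4)[of "f v"] by auto
  next
    case False
    then obtain i where "i < g" "f v = u i" using off offD(2) V_cases by metis
    then have "f (f v) = u (Suc i mod g)" using f_u by simp
    then show ?thesis using off u_notin_off[OF Suc_mod_less] by metis
  qed
qed

lemma pair_graph: "pair_graph G"
proof unfold_locales
  show "finite (parcs G)"
    by (rule finite_subset[of _ "V \<times> V"]) (use fin f_in in auto)
  show "Digraph.symmetric (with_proj G)"
    by (auto simp: symmetric_def sym_def)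
  fix e assume "e \<in> parcs G"
  then obtain x y where e: "e = (x, y)" and xy: "x \<in> V \<and> y = f x \<or> y \<in> V \<and> x = f y"
    by (cases e) simp
  from xy have "x \<in> V" "y \<in> V" "x \<noteq> y" using f_in f_neq by metis+
  then show "fst e \<in> pverts G" "snd e \<in> pverts G" "fst e \<noteq> snd e" by (simp_all add: e)
qed (use fin in simp)

sublocale pair_graph G by (rule pair_graph)

section \<open>Paths to the cycle and the distance function\<close>

lemma anc_u [simp]: "i < g \<Longrightarrow> anc (u i) = {}"
proof -
  assume "i < g"
  moreover have "\<exists>j<g. (f ^^ k) (u i) = u j" if "i < g" for k
  proof (induction k)
    case (Suc k)
    then obtain j where "j < g" "(f ^^ k) (u i) = u j" by blast
    then have "(f ^^ Suc k) (u i) = u (Suc j mod g)" using f_u by simp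
    then show ?case using Suc_mod_less by blast
  qed (use that in auto)
  ultimately have "(f ^^ k) (u i) \<notin> off" for k using u_notin_off by metis
  then show ?thesis unfolding anc_def by blast
qed

lemma anc_subset: "anc x \<subseteq> off"
  by (auto simp: anc_def)

lemma finite_anc: "finite (anc x)"
  using anc_subset finite_off by (rule finite_subset)

lemma anc_step: "x \<in> off \<Longrightarrow> anc x = insert x (anc (f x))"
proof (intro subset_antisym subsetI)
  fix v assume x: "x \<in> off" and "v \<in> anc x"
  then obtain k where k: "(f ^^ k) x = v" and v: "v \<in> off" by (auto simp: anc_def)
  show "v \<in> insert x (anc (f x))"
  proof (cases k)
    case (Suc k')
    then have "(f ^^ k') (f x) = v" using k by (simp add: funpow_swap1)
    then show ?thesis using v by (auto simp: anc_def)
  qed (use k in simp)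
next
  fix v assume x: "x \<in> off" and v: "v \<in> insert x (anc (f x))"
  show "v \<in> anc x"
  proof (cases "v = x")
    case True
    then show ?thesis using x by (auto simp: anc_def intro: exI[of _ 0])
  next
    case False
    then obtain k where "(f ^^ k) (f x) = v" "v \<in> off" using v by (auto simp: anc_def)
    then have "(f ^^ Suc k) x = v" by (simp add: funpow_swap1)
    then show ?thesis using \<open>v \<in> off\<close> unfolding anc_def by blast
  qed
qed

lemma V_induct [consumes 1, case_names cyc off]:
  assumes "x \<in> V" "\<And>i. i < g \<Longrightarrow> P (u i)" "\<And>x. x \<in> off \<Longrightarrow> P (f x) \<Longrightarrow> P x"
  shows "P x"
  using assms(1)
proof (induction "h x" arbitrary: x rule: less_induct)
  case less
  from less.prems show ?case
  proof (cases rule: V_cases)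
    case off
    then show ?thesis using less.hyps[of "f x"] offD assms(3) by blast
  next
    case (cyc i)
    then show ?thesis using assms(2) by blast
  qed
qed

lemma anc_h: "x \<in> V \<Longrightarrow> v \<in> anc x \<Longrightarrow> h v \<le> h x"
proof (induction rule: V_induct)
  case (off x)
  then show ?case using anc_step[of x] offD(4)[of x] by force
qed simp

lemma anc_ix: "x \<in> V \<Longrightarrow> v \<in> anc x \<Longrightarrow> ix v = ix x"
proof (induction rule: V_induct)
  case (off x)
  then show ?case using anc_step[of x] offD(3)[of x] by force
qed simp

lemma notin_anc_f: "x \<in> off \<Longrightarrow> x \<notin> anc (f x)"
  using anc_h[of "f x" x] offD by force

lemma self_in_anc: "x \<in> off \<Longrightarrow> x \<in> anc x"
  using anc_step by blast

lemma anc_trans: "x \<in> V \<Longrightarrow> v \<in> anc x \<Longrightarrow> anc v \<subseteq> anc x"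
proof (induction rule: V_induct)
  case (off x)
  then show ?case by (cases "v = x") (auto simp: anc_step[of x])
qed simp

text \<open>Within one branch, \<open>anc y \<subseteq> anc x\<close> says that \<open>y\<close>
  lies on the path from \<open>x\<close> to the root, the root included, where \<open>anc\<close> is
  empty. The witness is the vertex just before \<open>y\<close> on this path.\<close>

lemma ex_child_in_anc:
  assumes "x \<in> V" "y \<in> V" "y \<noteq> x" "ix x = ix y" "anc y \<subseteq> anc x"
  shows "\<exists>z\<in>off. f z = y \<and> z \<in> anc x"
  using assms(1,3,4,5)
proof (induction rule: V_induct)
  case (cyc i)
  then have "y \<notin> off" using self_in_anc by auto
  then obtain j where "j < g" "y = u j" using assms(2) V_cases by metis
  with cyc ix_u show ?case by metis
next
  case (off x)
  show ?case
  proof (cases "f x = y")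
    case True
    then show ?thesis using off self_in_anc by blast
  next
    case False
    \<comment> \<open>Otherwise \<open>h x \<le> h y \<le> h (f x) < h x\<close>.\<close>
    have "x \<notin> anc y"
    proof
      assume x: "x \<in> anc y"
      then have "h x \<le> h y" "y \<in> off"
        using anc_h assms(2) by (blast, metis V_cases anc_u empty_iff)
      moreover have "y \<in> anc (f x)"
        using self_in_anc[OF \<open>y \<in> off\<close>] off.prems anc_step[OF off.hyps] by auto
      then have "h y \<le> h (f x)" using anc_h offD(2) off.hyps by blast
      ultimately show False using offD(4)[OF off.hyps] by simp
    qed
    then have "anc y \<subseteq> anc (f x)" using off.prems anc_step[OF off.hyps] by auto
    moreover have "ix (f x) = ix y" using off.prems offD(3)[OF off.hyps] by simp
    ultimately show ?thesis
      using off.IH False anc_step[OF off.hyps] by blast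
  qed
qed

text \<open>One formula for both cases: within a branch the common part of the two paths to the
  cycle cancels and the cyclic term is 0; for different branches the sets \<open>anc\<close> are
  disjoint and both paths count in full.\<close>

definition "tdist x y = card ((anc x - anc y) \<union> (anc y - anc x)) + cyc_dist g (ix x) (ix y)"

lemma tdist_f_off:
  assumes "y \<in> off"
  shows "y \<notin> anc x \<Longrightarrow> tdist x y = Suc (tdist x (f y))"
    and "y \<in> anc x \<Longrightarrow> tdist x (f y) = Suc (tdist x y)"
proof -
  have y: "anc y = insert y (anc (f y))" "y \<notin> anc (f y)" "ix (f y) = ix y"
    using assms anc_step notin_anc_f offD(3) by blast+
  have fin: "finite ((anc x - anc z) \<union> (anc z - anc x))" for z
    using finite_anc by simp
  {
    assume "y \<notin> anc x"
    then have "(anc x - anc y) \<union> (anc y - anc x) = insert y ((anc x - anc (f y)) \<union> (anc (f y) - anc x))"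
      "y \<notin> (anc x - anc (f y)) \<union> (anc (f y) - anc x)"
      using y by auto
    then show "tdist x y = Suc (tdist x (f y))"
      using fin[of "f y"] y(3) by (simp add: tdist_def)
  next
    assume "y \<in> anc x"
    then have "(anc x - anc (f y)) \<union> (anc (f y) - anc x) = insert y ((anc x - anc y) \<union> (anc y - anc x))"
      "y \<notin> (anc x - anc y) \<union> (anc y - anc x)"
      using y by auto
    then show "tdist x (f y) = Suc (tdist x y)"
      using fin[of y] y(3) by (simp add: tdist_def)
  }
qed

lemma tdist_f_le:
  assumes "x \<in> V" "y \<in> V"
  shows "tdist x (f y) \<le> Suc (tdist x y)" "tdist x y \<le> Suc (tdist x (f y))"
proof -
  have "tdist x (f y) \<le> Suc (tdist x y) \<and> tdist x y \<le> Suc (tdist x (f y))"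
    using assms(2)
  proof (cases rule: V_cases)
    case (cyc i)
    then show ?thesis
      using cyc_dist_Suc_le[OF ix_less[OF assms(1)] cyc(1)] Suc_mod_less
      by (simp add: tdist_def f_u ix_u)
  next
    case off
    then show ?thesis using tdist_f_off[OF off, of x] by (cases "y \<in> anc x") auto
  qed
  then show "tdist x (f y) \<le> Suc (tdist x y)" "tdist x y \<le> Suc (tdist x (f y))" by auto
qed

text \<open>If \<open>y\<close> lies on the path from \<open>x\<close> to its root, step down
  towards \<open>x\<close>; otherwise a root moves along the cycle and any other vertex to its
  parent. Together with \<open>tdist_f_le\<close> this certifies \<open>tdist\<close> as the
  distance.\<close>

lemma tdist_decrease:
  assumes x: "x \<in> V" and y: "y \<in> V" "y \<noteq> x"
  shows "\<exists>z. (y, z) \<in> parcs G \<and> tdist x z < tdist x y"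
proof (cases "anc y \<subseteq> anc x \<and> ix x = ix y")
  case True
  then obtain z where z: "z \<in> off" "f z = y" "z \<in> anc x"
    using ex_child_in_anc x y by metis
  then have "tdist x z < tdist x y" using tdist_f_off(2) by force
  then show ?thesis using z offD(1) by auto
next
  case False
  show ?thesis
    using y(1)
  proof (cases rule: V_cases)
    case (cyc j)
    then have "ix x \<noteq> j" using False by (auto simp: ix_u)
    then obtain k where k: "k < g" "k = Suc j mod g \<or> j = Suc k mod g"
      "cyc_dist g (ix x) k < cyc_dist g (ix x) j"
      using cyc_dist_decrease ix_less x cyc(1) by metis
    then have "tdist x (u k) < tdist x y"
      using cyc by (simp add: tdist_def ix_u)
    moreover have "(y, u k) \<in> parcs G" using k cyc f_u u_in by auto
    ultimately show ?thesis by blast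
  next
    case off
    show ?thesis
    proof (cases "y \<in> anc x")
      case True
      then have "ix y = ix x" "anc y \<subseteq> anc x" using anc_ix anc_trans x by blast+
      with False show ?thesis by simp
    next
      case no: False
      then have "tdist x (f y) < tdist x y" using tdist_f_off(1)[OF off no] by simp
      then show ?thesis using y(1) by auto
    qed
  qed
qed

lemma
  assumes x: "x \<in> V" and y: "y \<in> V"
  shows graph_dist_eq: "graph_dist G x y = tdist x y"
    and relpow_tdist: "(x, y) \<in> parcs G ^^ tdist x y"
proof -
  have "tdist x z \<le> Suc (tdist x y)" if "(y, z) \<in> parcs G" for y z
    using that tdist_f_le[OF x] by auto
  moreover have "tdist x x = 0" by (simp add: tdist_def)
  ultimately show "graph_dist G x y = tdist x y" "(x, y) \<in> parcs G ^^ tdist x y"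
    using graph_dist_eqI[of "tdist x" x y] relpow_distI[of "tdist x" x y] tdist_decrease[OF x] x y
    by auto
qed

lemma connected: "Digraph_Component.connected (with_proj G)"
proof -
  have "V \<noteq> {}" using u_in[of 0] g3 by auto
  moreover have "(x, y) \<in> rtrancl_on V (parcs G)" if "x \<in> V" "y \<in> V" for x y
  proof -
    have "(x, y) \<in> rtrancl_on V (parcs G)" if "(x, y) \<in> parcs G ^^ k" for k
      using that
    proof (induction k arbitrary: y)
      case 0
      then show ?case using \<open>x \<in> V\<close> by auto
    next
      case (Suc k)
      then obtain z where "(x, z) \<in> parcs G ^^ k" "(z, y) \<in> parcs G" by auto
      moreover from this have "y \<in> V" using in_arcsD2 by auto
      ultimately show ?case using Suc.IH
        by (meson rtrancl_on_into_rtrancl_on)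
    qed
    then show ?thesis using relpow_tdist[OF that] by blast
  qed
  moreover have "(parcs G)\<^sup>s = parcs G" by (auto simp: symcl_def)
  ultimately show ?thesis by (simp add: connected_conv)
qed

section \<open>The Wiener index as a sum over edges\<close>

lemma sum_card_symdiff_anc:
  "(\<Sum>x\<in>V. \<Sum>y\<in>V. card ((anc x - anc y) \<union> (anc y - anc x))) =
   2 * (\<Sum>v\<in>off. below v * (card V - below v))"
proof -
  have ind: "card ((anc x - anc y) \<union> (anc y - anc x)) =
    (\<Sum>v\<in>off. of_bool (v \<in> anc x \<and> v \<notin> anc y) + of_bool (v \<in> anc y \<and> v \<notin> anc x))" for x y
  proof -
    have "card ((anc x - anc y) \<union> (anc y - anc x)) =
      (\<Sum>v\<in>off. of_bool (v \<in> (anc x - anc y) \<union> (anc y - anc x)))"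
      using anc_subset[of x] anc_subset[of y] finite_off
      by (simp add: of_bool_def sum.If_cases) (intro arg_cong[of _ _ card], blast)
    also have "\<dots> = (\<Sum>v\<in>off. of_bool (v \<in> anc x \<and> v \<notin> anc y) + of_bool (v \<in> anc y \<and> v \<notin> anc x))"
      by (rule sum.cong) auto
    finally show ?thesis .
  qed
  \<comment> \<open>For a fixed edge, the ordered pairs with only the first vertex beyond it form a
    product; exchanging the roles of \<open>x\<close> and \<open>y\<close> gives the factor
    2.\<close>
  have one: "(\<Sum>x\<in>V. \<Sum>y\<in>V. of_bool (v \<in> anc x \<and> v \<notin> anc y)) = below v * (card V - below v)" for v
  proof -
    have "(\<Sum>x\<in>V. \<Sum>y\<in>V. of_bool (v \<in> anc x \<and> v \<notin> anc y)) =
      (\<Sum>x\<in>V. of_bool (v \<in> anc x) * (\<Sum>y\<in>V. of_bool (v \<notin> anc y) :: nat))"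
      by (simp add: of_bool_conj sum_distrib_left)
    also have "\<dots> = (\<Sum>x\<in>V. of_bool (v \<in> anc x)) * (\<Sum>y\<in>V. of_bool (v \<notin> anc y) :: nat)"
      by (simp add: sum_distrib_right)
    also have "(\<Sum>x\<in>V. of_bool (v \<in> anc x) :: nat) = below v"
      using fin by (simp add: below_def of_bool_def sum.If_cases Int_def)
    also have "(\<Sum>y\<in>V. of_bool (v \<notin> anc y) :: nat) = card {y \<in> V. v \<notin> anc y}"
      using fin by (simp add: of_bool_def sum.If_cases Int_def)
    also have "{y \<in> V. v \<notin> anc y} = V - {y \<in> V. v \<in> anc y}" by auto
    also have "card (V - {y \<in> V. v \<in> anc y}) = card V - below v"
      using fin by (simp add: below_def card_Diff_subset)
    finally show ?thesis .
  qed
  have "(\<Sum>x\<in>V. \<Sum>y\<in>V. card ((anc x - anc y) \<union> (anc y - anc x))) =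
    (\<Sum>v\<in>off. (\<Sum>x\<in>V. \<Sum>y\<in>V. of_bool (v \<in> anc x \<and> v \<notin> anc y)) +
      (\<Sum>x\<in>V. \<Sum>y\<in>V. of_bool (v \<in> anc y \<and> v \<notin> anc x)))"
    unfolding ind by (simp add: sum.swap[of _ off V] sum.distrib)
  also have "\<dots> = (\<Sum>v\<in>off. 2 * (below v * (card V - below v)))"
    using one by (subst (2) sum.swap) (simp add: one mult_2)
  finally show ?thesis by (simp add: sum_distrib_left)
qed

lemma sum_by_ix: "(\<Sum>x\<in>V. F (ix x)) = (\<Sum>i<g. bsize i * (F i :: nat))"
proof -
  have "(\<Sum>x\<in>V. F (ix x)) = (\<Sum>i<g. \<Sum>x\<in>{x \<in> V. ix x = i}. F (ix x))"
    using fin ix_less by (intro sum.group[symmetric]) auto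
  then show ?thesis by (simp add: bsize_def)
qed

lemma double_wiener_eq:
  "2 * wiener_index G = 2 * (\<Sum>v\<in>off. below v * (card V - below v)) +
    (\<Sum>i<g. \<Sum>j<g. bsize i * bsize j * cyc_dist g i j)"
proof -
  have "2 * wiener_index G = (\<Sum>x\<in>V. \<Sum>y\<in>V. tdist x y)"
    using double_wiener_index graph_dist_eq by simp
  also have "\<dots> = 2 * (\<Sum>v\<in>off. below v * (card V - below v)) +
     (\<Sum>x\<in>V. \<Sum>y\<in>V. cyc_dist g (ix x) (ix y))"
    by (simp add: tdist_def sum.distrib sum_card_symdiff_anc)
  also have "(\<Sum>x\<in>V. \<Sum>y\<in>V. cyc_dist g (ix x) (ix y)) =
    (\<Sum>i<g. bsize i * (\<Sum>j<g. bsize j * cyc_dist g i j))"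
    by (simp add: sum_by_ix sum_by_ix[of "\<lambda>i. \<Sum>j<g. bsize j * cyc_dist g i j"])
  finally show ?thesis by (simp add: sum_distrib_left mult.assoc)
qed

lemma sum_bsize: "(\<Sum>i<g. bsize i) = card V"
  using sum_by_ix[of "\<lambda>_. 1"] by simp

lemma sum_binner: "(\<Sum>i<g. binner i) = card inner"
proof -
  have "card inner = (\<Sum>i<g. \<Sum>v\<in>{v \<in> inner. ix v = i}. 1)"
    using finite_inner offD(5) by (subst sum.group) (auto simp: inner_def)
  then show ?thesis by (simp add: binner_def)
qed

lemma below_eq_1: "v \<in> off \<Longrightarrow> v \<notin> inner \<Longrightarrow> below v = 1"
proof -
  assume v: "v \<in> off" "v \<notin> inner"
  have "x = v" if "x \<in> V" "v \<in> anc x" for x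
    using that
  proof (induction rule: V_induct)
    case (off x)
    then show ?case using v anc_step[of x] by (auto simp: inner_def)
  qed simp
  then have "{x \<in> V. v \<in> anc x} = {v}" using v self_in_anc offD(1) by blast
  then show ?thesis by (simp add: below_def)
qed

lemma below_ge_2: "v \<in> inner \<Longrightarrow> 2 \<le> below v"
proof -
  assume v: "v \<in> inner"
  then obtain w where w: "w \<in> off" "f w = v" "v \<in> off" by (auto simp: inner_def)
  then have "{v, w} \<subseteq> {x \<in> V. v \<in> anc x}" "v \<noteq> w"
    using self_in_anc anc_step[of w] offD(1) offD(4)[of w] by auto
  then have "card {v, w} \<le> below v"
    unfolding below_def using fin by (intro card_mono) auto
  then show ?thesis using \<open>v \<noteq> w\<close> by simp
qed

lemma below_le: "below v + g \<le> card V"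
proof -
  have "{x \<in> V. v \<in> anc x} \<subseteq> off" using V_cases by (metis (no_types, lifting) anc_u empty_iff mem_Collect_eq subsetI)
  then have "below v \<le> card off" unfolding below_def using finite_off by (rule card_mono[rotated])
  then show ?thesis using card_off by simp
qed

text \<open>With \<open>s = below v\<close> and \<open>n = card V\<close>, the difference of the two
  sides is \<open>(s - 2) * (n - s - 2)\<close>. The second factor is positive since no vertex of
  the cycle lies beyond the edge, so that \<open>n - s \<ge> g \<ge> 3\<close>.\<close>

lemma below_product_inner:
  assumes "v \<in> inner"
  shows "2 * (card V - 2) \<le> below v * (card V - below v)"
    and "2 < below v \<Longrightarrow> 2 * (card V - 2) < below v * (card V - below v)"
proof -
  have s: "2 \<le> below v" "below v + 3 \<le> card V"
    using below_ge_2[OF assms] below_le[of v] g3 by auto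
  define a b where "a = below v - 2" and "b = card V - below v - 3"
  have ab: "below v = a + 2" "card V = a + b + 5" using s by (auto simp: a_def b_def)
  show "2 * (card V - 2) \<le> below v * (card V - below v)"
    unfolding ab by (simp add: algebra_simps)
  show "2 * (card V - 2) < below v * (card V - below v)" if "2 < below v"
    using that unfolding ab by (simp add: algebra_simps)
qed

lemma sum_off_split:
  "(\<Sum>v\<in>off. below v * (card V - below v)) =
   (card V - g - card inner) * (card V - 1) + (\<Sum>v\<in>inner. below v * (card V - below v))"
proof -
  have sub: "inner \<subseteq> off" by (auto simp: inner_def)
  have "(\<Sum>v\<in>off. below v * (card V - below v)) =
    (\<Sum>v\<in>off - inner. below v * (card V - below v)) + (\<Sum>v\<in>inner. below v * (card V - below v))"
    using sub finite_off by (rule sum.subset_diff)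
  also have "(\<Sum>v\<in>off - inner. below v * (card V - below v)) = card (off - inner) * (card V - 1)"
    by (simp add: below_eq_1)
  also have "card (off - inner) = card V - g - card inner"
    using card_off card_Diff_subset[OF finite_inner sub] by simp
  finally show ?thesis .
qed

end

text \<open>Twice the Wiener index when the branches have orders \<open>t i\<close> and contain \<open>N\<close> pendant paths of
  length 2 and otherwise only pendant edges at the roots.\<close>

definition config_cost :: "nat \<Rightarrow> (nat \<Rightarrow> nat) \<Rightarrow> nat \<Rightarrow> nat" where
  "config_cost g t N = 2 * (((\<Sum>i<g. t i) - g) * ((\<Sum>i<g. t i) - 1) + N * ((\<Sum>i<g. t i) - 3)) +
    (\<Sum>i<g. \<Sum>j<g. t i * t j * cyc_dist g i j)"

context rooted_cycle
begin

text \<open>Each of the \<open>m\<close> inner edges replaces a term \<open>n - 1\<close> by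
  \<open>2 * (n - 2)\<close>, an increase of \<open>n - 3\<close>. This is the coefficient of
  \<open>N\<close> in \<open>config_cost\<close>.\<close>

lemma leaves_product_eq:
  assumes "m \<le> n - g" "g \<le> n" "3 \<le> g"
  shows "(n - g - m) * (n - 1) + m * (2 * (n - 2)) = (n - g) * (n - 1) + m * (n - 3)"
proof -
  obtain k l where "n - g = m + k" "n = l + 3"
    using assms by (metis le_add_diff_inverse le_add_diff_inverse2 le_trans)
  then show ?thesis by (simp add: algebra_simps)
qed

lemma card_inner_le: "card inner \<le> card V - g"
  using card_mono[OF finite_off, of inner] card_off by (force simp: inner_def)

lemma g_le_card: "g \<le> card V"
  using card_off by simp

lemma double_wiener_eq_cost:
  assumes "\<And>v. v \<in> inner \<Longrightarrow> below v = 2"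
  shows "2 * wiener_index G = config_cost g bsize (card inner)"
  using leaves_product_eq[OF card_inner_le g_le_card g3] assms
  by (simp add: double_wiener_eq sum_off_split config_cost_def sum_bsize)

lemma double_wiener_gt_cost:
  assumes "w \<in> inner" "below w \<noteq> 2"
  shows "2 * wiener_index G > config_cost g bsize (card inner)"
proof -
  have "(\<Sum>v\<in>inner. 2 * (card V - 2)) < (\<Sum>v\<in>inner. below v * (card V - below v))"
  proof (intro sum_strict_mono_ex1 ballI bexI)
    show "2 * (card V - 2) < below w * (card V - below w)"
      using assms below_product_inner(2)[OF assms(1)] below_ge_2[OF assms(1)] by simp
  qed (simp_all add: assms finite_inner below_product_inner)
  then show ?thesis
    using leaves_product_eq[OF card_inner_le g_le_card g3]
    by (simp add: double_wiener_eq sum_off_split config_cost_def sum_bsize)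
qed

end

section \<open>Uniqueness of the cycle, and the girth\<close>

lemma cyclic_neighbours:
  assumes "i < k" "3 \<le> (k::nat)"
  obtains l where "l < k" "Suc l mod k = i" "l \<noteq> Suc i mod k"
proof -
  define l where "l = (if i = 0 then k - 1 else i - 1)"
  have "l < k" "Suc l mod k = i" "l \<noteq> Suc i mod k"
    using assms by (auto simp: l_def Suc_mod_eq split: if_splits)
  then show thesis using that by blast
qed

lemma all_of_closed_Suc_mod:
  assumes "i \<in> I" "I \<subseteq> {..<g}" "\<And>j. j \<in> I \<Longrightarrow> Suc j mod g \<in> I"
  shows "I = {..<g}"
proof -
  have "(i + m) mod g \<in> I" for m
  proof (induction m)
    case 0
    then show ?case using assms(1,2) by auto
  next
    case (Suc m)
    then show ?case using assms(3)[OF Suc] by (simp add: mod_Suc_eq)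
  qed
  moreover have "(i + (l + g - i)) mod g = l" if "l < g" for l
    using that assms(1,2) by auto
  ultimately show ?thesis using assms(2) by (metis lessThan_iff subsetI subset_antisym)
qed

context rooted_cycle
begin

definition "cyc_arcs = {(u i, u (Suc i mod g)) | i. i < g}"

lemma off_child: "x \<in> V \<Longrightarrow> f x \<in> off \<Longrightarrow> x \<in> off"
  using V_cases f_u u_notin_off Suc_mod_less by metis

text \<open>A cycle has two distinct neighbours at each of its vertices. If it met
  \<open>off\<close>, then at such a vertex of maximal \<open>h\<close> both neighbours would be the
  parent. So it stays on the vertices \<open>u i\<close>, and there it is closed under
  successors.\<close>

lemma graph_cycle_unique:
  assumes "graph_cycle G p"
  shows "length p = g" "symcl (set p) = symcl cyc_arcs"
proof -
  obtain c where inj: "inj_on c {..<length p}" and k3: "3 \<le> length p"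
    and p: "p = map (\<lambda>i. (c i, c (Suc i mod length p))) [0..<length p]"
    and arc: "\<And>i. i < length p \<Longrightarrow> (c i, c (Suc i mod length p)) \<in> parcs G"
    using graph_cycleE[OF assms] by blast
  define k where "k = length p"
  note inj = inj[folded k_def] and k3 = k3[folded k_def] and arc = arc[folded k_def]
  have set_p: "set p = {(c i, c (Suc i mod k)) | i. i < k}"
    by (subst p) (auto simp: k_def)
  have ck: "c i \<in> V" if "i < k" for i
    using arc[OF that] in_arcsD1 by simp
  have suc_less: "Suc i mod k < k" for i using k3 by simp
  have two: "\<exists>l<k. c l \<noteq> c (Suc i mod k) \<and> (c l, c i) \<in> set p" if "i < k" for i
  proof -
    obtain l where l: "l < k" "Suc l mod k = i" "l \<noteq> Suc i mod k"
      using cyclic_neighbours[OF \<open>i < k\<close> k3] .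
    moreover have "c l \<noteq> c (Suc i mod k)" using inj l suc_less by (auto dest: inj_onD)
    ultimately show ?thesis using set_p by blast
  qed
  have step: "(c i, c (Suc i mod k)) \<in> set p" if "i < k" for i
    using that set_p by blast
  have arcs_p: "set p \<subseteq> parcs G"
  proof
    fix e assume "e \<in> set p"
    then obtain i where "i < k" "e = (c i, c (Suc i mod k))" using set_p by blast
    then show "e \<in> parcs G" using arc by simp
  qed
  have no_off: "c i \<notin> off" if "i < k" for i
  proof
    assume "c i \<in> off"
    define I where "I = {i \<in> {..<k}. c i \<in> off}"
    have I: "finite I" "I \<noteq> {}" using \<open>i < k\<close> \<open>c i \<in> off\<close> by (auto simp: I_def)
    then have "Max ((\<lambda>l. h (c l)) ` I) \<in> (\<lambda>l. h (c l)) ` I" by (intro Max_in) auto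
    then obtain j where "j \<in> I" "h (c j) = Max ((\<lambda>l. h (c l)) ` I)" by auto
    then have j: "j \<in> I" "\<And>l. l \<in> I \<Longrightarrow> h (c l) \<le> h (c j)" using I by auto
    \<comment> \<open>Any neighbour other than the parent is a child, hence again in
      \<open>off\<close> and of larger \<open>h\<close>, against maximality.\<close>
    have nb: "c l = f (c j)" if "l < k" "(c l, c j) \<in> parcs G" for l
    proof (rule ccontr)
      assume "c l \<noteq> f (c j)"
      then have "c j = f (c l)" using that by auto
      moreover from this have "c l \<in> off" using off_child ck that(1) j(1) by (auto simp: I_def)
      ultimately have "h (c j) < h (c l)" "l \<in> I" using offD(4) that(1) by (auto simp: I_def)
      with j(2) show False by fastforce
    qed
    have "j < k" using j(1) by (auto simp: I_def)
    then obtain l where l: "l < k" "c l \<noteq> c (Suc j mod k)" "(c l, c j) \<in> set p"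
      using two by blast
    have "c l = f (c j)" using nb l arcs_p by blast
    moreover have "c (Suc j mod k) = f (c j)"
      using nb suc_less arc[OF \<open>j < k\<close>] arcs_symmetric by blast
    ultimately show False using l(2) by simp
  qed
  define I where "I = {j \<in> {..<g}. u j \<in> c ` {..<k}}"
  have on: "\<exists>j\<in>I. c i = u j" if "i < k" for i
    using ck[OF that]
  proof (cases rule: V_cases)
    case (cyc j)
    then have "u j \<in> c ` {..<k}" using that by (metis image_eqI lessThan_iff)
    then show ?thesis using cyc by (auto simp: I_def)
  next
    case off
    then show ?thesis using no_off that by blast
  qed
  have nxt: "(u j, u (Suc j mod g)) \<in> symcl (set p) \<and> Suc j mod g \<in> I" if j: "j \<in> I" for j
  proof -
    obtain i where i: "i < k" "c i = u j" "j < g" using j by (auto simp: I_def)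
    obtain l where l: "l < k" "c l \<noteq> c (Suc i mod k)" "(c l, c i) \<in> set p"
      using two i by blast
    \<comment> \<open>If neither neighbour of \<open>u j\<close> were its successor, both would be
      its predecessor, which is unique.\<close>
    have pre: "y = u (Suc j mod g)" if "y = u m" "m < g" "(y, u j) \<in> parcs G" "z = u n" "n < g"
      "(u j, z) \<in> parcs G" "z \<noteq> y" "z \<noteq> u (Suc j mod g)" for y z m n
    proof (rule ccontr)
      assume "y \<noteq> u (Suc j mod g)"
      then have "u j = f y" using that(3) i(3) f_u by auto
      moreover have "u j = f z" using that(6,8) i(3) f_u by auto
      ultimately have "u j = u (Suc m mod g)" "u j = u (Suc n mod g)"
        using that(1,2,4,5) f_u by auto
      then have "Suc m mod g = j" "Suc n mod g = j"
        using i(3) ix_u Suc_mod_less by metis+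
      then have "m = n" using that(2,5) by (auto simp: Suc_mod_eq split: if_splits)
      then show False using that by simp
    qed
    obtain m n where mn: "m < g" "c l = u m" "n < g" "c (Suc i mod k) = u n"
      using on[OF l(1)] on[OF suc_less, of i] by (auto simp: I_def)
    have "c l = u (Suc j mod g) \<or> c (Suc i mod k) = u (Suc j mod g)"
      using pre[OF mn(2,1) _ mn(4,3)] l arcs_p arc[OF i(1)] i by auto
    then show ?thesis
    proof
      assume s: "c l = u (Suc j mod g)"
      then have "u (Suc j mod g) \<in> c ` {..<k}" using l(1) by (metis image_eqI lessThan_iff)
      moreover have "(u (Suc j mod g), u j) \<in> set p" using s l(3) i by simp
      ultimately show ?thesis using Suc_mod_less by (force simp: symcl_def I_def)
    next
      assume s: "c (Suc i mod k) = u (Suc j mod g)"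
      then have "u (Suc j mod g) \<in> c ` {..<k}" using suc_less by (metis image_eqI lessThan_iff)
      then show ?thesis using s step[OF i(1)] i Suc_mod_less by (auto simp: symcl_def I_def)
    qed
  qed
  have I: "I = {..<g}"
  proof -
    have "0 < k" using k3 by simp
    then obtain j where "j \<in> I" using on by blast
    moreover have "I \<subseteq> {..<g}" by (auto simp: I_def)
    ultimately show ?thesis using all_of_closed_Suc_mod nxt by blast
  qed
  have "c ` {..<k} = u ` {..<g}"
  proof (intro subset_antisym subsetI)
    fix x assume "x \<in> c ` {..<k}"
    then show "x \<in> u ` {..<g}" using on I by auto
  next
    fix x assume "x \<in> u ` {..<g}"
    then obtain j where "j \<in> I" "x = u j" using I by blast
    then show "x \<in> c ` {..<k}" by (simp add: I_def)
  qed
  then have "k = g" using card_image[OF inj] card_image[OF inj_u] by simp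
  then show "length p = g" by (simp add: k_def)
  have "symcl cyc_arcs \<subseteq> symcl (set p)"
  proof -
    have "cyc_arcs \<subseteq> symcl (set p)" using nxt I by (auto simp: cyc_arcs_def)
    then show ?thesis by (fastforce simp: symcl_def)
  qed
  moreover have "set p \<subseteq> symcl cyc_arcs"
  proof
    fix e assume "e \<in> set p"
    then obtain i where i: "i < k" "e = (c i, c (Suc i mod k))" using set_p by blast
    obtain a b where ab: "a < g" "c i = u a" "b < g" "c (Suc i mod k) = u b"
      using on[OF i(1)] on[OF suc_less, of i] I by auto
    then have "u b = u (Suc a mod g) \<or> u a = u (Suc b mod g)"
      using arc[OF i(1)] f_u by auto
    then show "e \<in> symcl cyc_arcs"
      using ab i by (auto simp: cyc_arcs_def symcl_def image_iff)
  qed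
  then have "symcl (set p) \<subseteq> symcl cyc_arcs" by (auto simp: symcl_def)
  ultimately show "symcl (set p) = symcl cyc_arcs" by blast
qed

lemma ex_graph_cycle: "\<exists>p. graph_cycle G p"
proof -
  have "(u i, u (Suc i mod g)) \<in> parcs G" if "i < g" for i
    using that u_in f_u by auto
  then show ?thesis using graph_cycleI[OF inj_u g3] by blast
qed

lemma girth_eq: "girth G = g"
proof -
  have "(\<lambda>k. \<exists>p. graph_cycle G p \<and> length p = k) = (\<lambda>k. k = g)"
    using ex_graph_cycle graph_cycle_unique(1) by blast
  then show ?thesis unfolding girth_def by (simp add: Least_equality)
qed

lemma unicyclic: "unicyclic G"
proof -
  have "cycle_subgraphs G = {symcl cyc_arcs}"
    using ex_graph_cycle graph_cycle_unique(2) by (auto simp: cycle_subgraphs_def)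
  then show ?thesis
    using pair_graph connected by (simp add: unicyclic_def)
qed

end

section \<open>Every unicyclic graph is a functional graph\<close>

lemma (in pair_graph) connected_imp_relpow:
  assumes "Digraph_Component.connected (with_proj G)" "x \<in> pverts G" "y \<in> pverts G"
  shows "\<exists>k. (x, y) \<in> parcs G ^^ k"
proof -
  have "symcl (parcs G) = parcs G" using arcs_symmetric by (auto simp: symcl_def)
  then have "(x, y) \<in> rtrancl_on (pverts G) (parcs G)"
    using assms by (simp add: connected_conv)
  then have "(x, y) \<in> (parcs G)\<^sup>*"
    by (induction rule: rtrancl_on_induct) auto
  then show ?thesis by (simp add: rtrancl_is_UN_relpow)
qed

text \<open>Take a shortest cycle and let \<open>h\<close> be the distance to it. \<open>f\<close>
  runs around the cycle and sends every other vertex one step closer. An edge not given by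
  \<open>f\<close> would create a second cycle.\<close>

lemma unicyclic_imp_rooted_cycle:
  assumes "unicyclic G" "girth G = g"
  obtains f u ix h where "rooted_cycle (pverts G) f u g ix h" "G = fun_graph (pverts G) f"
proof -
  interpret pair_graph G using assms(1) by (simp add: unicyclic_def)
  let ?V = "pverts G"
  have conn: "\<exists>k. (x, y) \<in> parcs G ^^ k" if "x \<in> ?V" "y \<in> ?V" for x y
    using assms(1) that connected_imp_relpow by (simp add: unicyclic_def)
  obtain p0 where "graph_cycle G p0"
    using assms(1) by (auto simp: unicyclic_def cycle_subgraphs_def)
  then have "\<exists>k p. graph_cycle G p \<and> length p = k" by blast
  then have "\<exists>p. graph_cycle G p \<and> length p = girth G"
    unfolding girth_def by (rule LeastI_ex)
  then obtain p where p: "graph_cycle G p" "length p = g" using assms(2) by blast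
  obtain c where inj: "inj_on c {..<g}" and g3: "3 \<le> g"
    and p_eq: "p = map (\<lambda>i. (c i, c (Suc i mod g))) [0..<g]"
    and arc: "\<And>i. i < g \<Longrightarrow> (c i, c (Suc i mod g)) \<in> parcs G"
  proof -
    show thesis by (rule graph_cycleE[OF p(1), unfolded p(2)]) (rule that)
  qed
  let ?C = "c ` {..<g}"
  have C_V: "?C \<subseteq> ?V" using arc in_arcsD1 by blast
  have c0: "c 0 \<in> ?C" using g3 by auto
  define h where "h v = (LEAST k. \<exists>w\<in>?C. (v, w) \<in> parcs G ^^ k)" for v
  have h_ex: "\<exists>w\<in>?C. (v, w) \<in> parcs G ^^ h v" if v: "v \<in> ?V" for v
  proof -
    obtain k where "(v, c 0) \<in> parcs G ^^ k" using conn[OF v, of "c 0"] c0 C_V by blast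
    then have "\<exists>k. \<exists>w\<in>?C. (v, w) \<in> parcs G ^^ k" using c0 by blast
    then show ?thesis unfolding h_def by (rule LeastI_ex)
  qed
  have h_le: "h v \<le> k" if "w \<in> ?C" "(v, w) \<in> parcs G ^^ k" for v w k
    unfolding h_def using that by (intro Least_le) blast
  have h_C: "h v = 0" if "v \<in> ?C" for v
    using h_le[OF that, of v 0] by simp
  have h_0: "v \<in> ?C" if "v \<in> ?V" "h v = 0" for v
    using h_ex[OF that(1)] that(2) by auto
  define par where "par v = (SOME w. (v, w) \<in> parcs G \<and> Suc (h w) = h v)" for v
  have par: "(v, par v) \<in> parcs G \<and> Suc (h (par v)) = h v" if v: "v \<in> ?V" "v \<notin> ?C" for v
  proof -
    obtain w where w: "w \<in> ?C" "(v, w) \<in> parcs G ^^ h v" using h_ex v by blast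
    obtain k where k: "h v = Suc k" using h_0 v by (cases "h v") auto
    then obtain x where x: "(v, x) \<in> parcs G" "(x, w) \<in> parcs G ^^ k"
      using w by (metis relpow_Suc_D2)
    have "x \<in> ?V" using x(1) in_arcsD2 by blast
    obtain w' where "w' \<in> ?C" "(x, w') \<in> parcs G ^^ h x" using h_ex[OF \<open>x \<in> ?V\<close>] by blast
    then have "h v \<le> Suc (h x)" using h_le x(1) relpow_Suc_I2 by metis
    moreover have "h x \<le> k" using h_le w(1) x(2) by blast
    ultimately have "Suc (h x) = h v" using k by simp
    then have "\<exists>w. (v, w) \<in> parcs G \<and> Suc (h w) = h v" using x(1) by blast
    then show ?thesis unfolding par_def by (rule someI_ex)
  qed
  define idx where "idx = inv_into {..<g} c"
  have idx: "idx (c i) = i" if "i < g" for i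
    using that inj by (simp add: idx_def)
  define f where "f v = (if v \<in> ?C then c (Suc (idx v) mod g) else par v)" for v
  have f_arc: "(v, f v) \<in> parcs G" if "v \<in> ?V" for v
    using that par arc idx by (auto simp: f_def)
  define ix where "ix v = idx ((f ^^ h v) v)" for v
  have root: "(f ^^ h v) v \<in> ?C" if "v \<in> ?V" for v
    using that
  proof (induction "h v" arbitrary: v)
    case 0
    then show ?case using h_0[of v] by simp
  next
    case (Suc k)
    then have "v \<notin> ?C" using h_C by force
    then have "Suc (h (f v)) = h v" "f v \<in> ?V"
      using Suc.prems par[of v] f_arc[of v] in_arcsD2 by (auto simp: f_def)
    then show ?case using Suc.hyps(1)[of "f v"] Suc.hyps(2) by (metis Suc_inject funpow_swap1 funpow.simps(2) comp_apply)
  qed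
  have ix_c: "ix (c i) = i" if "i < g" for i
    using that h_C idx by (simp add: ix_def)
  have R: "rooted_cycle ?V f c g ix h"
  proof
    fix v assume v: "v \<in> ?V"
    show "ix v < g" using root[OF v] idx by (auto simp: ix_def)
    assume "v \<noteq> c (ix v)"
    then have "v \<notin> ?C" using ix_c by auto
    then have 1: "Suc (h (f v)) = h v" using par[OF v] by (simp add: f_def)
    then have "(f ^^ h v) v = (f ^^ h (f v)) (f v)"
      by (metis funpow_swap1 funpow.simps(2) comp_apply)
    then show "f v \<in> ?V \<and> ix (f v) = ix v \<and> h (f v) < h v"
      using 1 f_arc[OF v] in_arcsD2 by (auto simp: ix_def)
  next
    show "f (c i) = c (Suc i mod g)" if "i < g" for i
      using that idx by (simp add: f_def)
  qed (use C_V g3 ix_c pair_finite_verts in auto)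
  \<comment> \<open>The locale only speaks of \<open>f\<close>, so the functional graph is known to
    be connected before it is known to be all of \<open>G\<close>.\<close>
  interpret R: rooted_cycle ?V f c g ix h by (rule R)
  have sub: "parcs (fun_graph ?V f) \<subseteq> parcs G"
    using f_arc arcs_symmetric by (auto simp: fun_graph_def)
  \<comment> \<open>An arc missed by \<open>f\<close> closes a path of the functional graph to a
    cycle of \<open>G\<close>. Its edges must be those of \<open>p\<close>, but these all come from
    \<open>f\<close>.\<close>
  have "(x, y) \<in> parcs (fun_graph ?V f)" if xy: "(x, y) \<in> parcs G" for x y
  proof (rule ccontr)
    assume no: "(x, y) \<notin> parcs (fun_graph ?V f)"
    have V: "x \<in> ?V" "y \<in> ?V" "x \<noteq> y" using xy in_arcsD1 in_arcsD2 no_loops' by blast+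
    then obtain q0 where "R.awalk y q0 x"
      using R.relpow_tdist[of y x] R.ex_awalk_iff_relpow[of y x] by auto
    then obtain q where q: "R.apath y q x" using R.apath_awalk_to_apath by blast
    then have w: "R.awalk y q x" "distinct (pawalk_verts y q)" by (auto simp: R.apath_def)
    have "awalk y q x" using w(1) sub V by (auto simp: R.awalk_def awalk_def)
    then have "cycle ((x, y) # q)"
      unfolding cycle_def using w(2) xy V by (intro exI[of _ x]) (auto simp: awalk_Cons_iff)
    moreover have "2 \<le> length q"
    proof (rule ccontr)
      assume "\<not> 2 \<le> length q"
      then consider "q = []" | e where "q = [e]" by (cases q; cases "tl q") auto
      then show False
      proof cases
        case 1
        then show ?thesis using w(1) V by (simp add: R.awalk_def)
      next
        case 2
        then have "(y, x) \<in> parcs (fun_graph ?V f)" using w(1) by (cases e) (auto simp: R.awalk_def simp del: fun_graph_simps)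
        then show ?thesis using no by auto
      qed
    qed
    ultimately have "graph_cycle G ((x, y) # q)" by (simp add: graph_cycle_def)
    then have "symcl (set ((x, y) # q)) = symcl (set p)"
      using assms(1) p(1) unfolding unicyclic_def cycle_subgraphs_def by blast
    then have "(x, y) \<in> symcl (set p)" by (auto simp: symcl_def)
    moreover have "symcl (set p) \<subseteq> parcs (fun_graph ?V f)"
    proof -
      have "set p \<subseteq> parcs (fun_graph ?V f)"
        unfolding p_eq using R.f_u R.u_in by (auto simp: fun_graph_def)
      then show ?thesis using R.arcs_symmetric by (auto simp: symcl_def simp del: fun_graph_simps)
    qed
    ultimately show False using no by blast
  qed
  then have "parcs G = parcs (fun_graph ?V f)" using sub by auto
  then have "G = fun_graph ?V f" by (simp add: fun_graph_def)
  with R show thesis using that by blast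
qed

section \<open>Matching numbers\<close>

text \<open>The matching number of the cycle \<open>0, \<dots>, g - 1\<close> with one pendant edge at each element of
  \<open>S\<close>: \<open>Y\<close> collects the matched cycle edges \<open>{i, i + 1}\<close>, \<open>P\<close> the matched pendant edges.\<close>

definition sun_matchings :: "nat \<Rightarrow> nat set \<Rightarrow> (nat set \<times> nat set) set" where
  "sun_matchings g S = {(Y, P). Y \<subseteq> {..<g} \<and> P \<subseteq> S \<and> Y \<inter> P = {} \<and>
     (\<lambda>i. Suc i mod g) ` Y \<inter> (Y \<union> P) = {}}"

definition sun_number :: "nat \<Rightarrow> nat set \<Rightarrow> nat" where
  "sun_number g S = Max ((\<lambda>(Y, P). card Y + card P) ` sun_matchings g S)"

lemma finite_sun_matchings: "finite S \<Longrightarrow> finite (sun_matchings g S)"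
  by (rule finite_subset[of _ "Pow {..<g} \<times> Pow S"]) (auto simp: sun_matchings_def)

lemma sun_number_ge:
  "finite S \<Longrightarrow> (Y, P) \<in> sun_matchings g S \<Longrightarrow> card Y + card P \<le> sun_number g S"
  unfolding sun_number_def using finite_sun_matchings by (intro Max_ge) auto

lemma sun_number_attained:
  assumes "finite S"
  obtains Y P where "(Y, P) \<in> sun_matchings g S" "card Y + card P = sun_number g S"
proof -
  have "({}, {}) \<in> sun_matchings g S" by (auto simp: sun_matchings_def)
  then have "sun_number g S \<in> (\<lambda>(Y, P). card Y + card P) ` sun_matchings g S"
    unfolding sun_number_def using finite_sun_matchings[OF assms] by (intro Max_in) auto
  then show thesis using that by auto
qed

lemma sun_number_mono:
  assumes "S \<subseteq> T" "finite T"
  shows "sun_number g S \<le> sun_number g T"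
proof -
  obtain Y P where YP: "(Y, P) \<in> sun_matchings g S" "card Y + card P = sun_number g S"
    using sun_number_attained finite_subset[OF assms] by blast
  then have "(Y, P) \<in> sun_matchings g T" using assms(1) by (auto simp: sun_matchings_def)
  then show ?thesis using sun_number_ge[OF assms(2)] YP(2) by metis
qed

lemma sun_number_insert_le:
  assumes "finite S"
  shows "sun_number g (insert i S) \<le> Suc (sun_number g S)"
proof -
  obtain Y P where YP: "(Y, P) \<in> sun_matchings g (insert i S)"
    "card Y + card P = sun_number g (insert i S)"
    using sun_number_attained assms finite_insert by metis
  then have "(Y, P - {i}) \<in> sun_matchings g S" by (auto simp: sun_matchings_def)
  then have "card Y + card (P - {i}) \<le> sun_number g S" using sun_number_ge assms by blast
  moreover have "finite P" using YP(1) assms by (auto simp: sun_matchings_def intro: finite_subset)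
  then have "card P \<le> Suc (card (P - {i}))" by (simp add: card_Diff_singleton_if) arith
  ultimately show ?thesis using YP(2) by linarith
qed

text \<open>A configuration \<open>(t, a)\<close> prescribes the order \<open>t i\<close> of the \<open>i\<close>-th branch, which consists of \<open>a i\<close>
  pendant paths of length 2 and \<open>t i - 1 - 2 * a i\<close> pendant edges at the root.\<close>

definition config_matching :: "nat \<Rightarrow> (nat \<Rightarrow> nat) \<Rightarrow> (nat \<Rightarrow> nat) \<Rightarrow> nat" where
  "config_matching g t a = (\<Sum>i<g. a i) + sun_number g {i \<in> {..<g}. 2 * a i + 1 < t i}"

lemma config_matching_cong:
  assumes "\<And>i. i < g \<Longrightarrow> t i = t' i" "\<And>i. i < g \<Longrightarrow> a i = a' i"
  shows "config_matching g t a = config_matching g t' a'"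
proof -
  have "{i \<in> {..<g}. 2 * a i + 1 < t i} = {i \<in> {..<g}. 2 * a' i + 1 < t' i}" using assms by auto
  then show ?thesis using assms by (simp add: config_matching_def)
qed

text \<open>At fixed orders, one more path at branch \<open>i\<close> adds one to the sum and
  removes at most \<open>i\<close> from the set of roots with a pendant edge, which lowers the sun
  number by at most one.\<close>

lemma config_matching_incr:
  assumes "i < g"
  shows "config_matching g t a \<le> config_matching g t (a(i := Suc (a i)))"
    and "config_matching g t (a(i := Suc (a i))) \<le> Suc (config_matching g t a)"
proof -
  let ?a = "a(i := Suc (a i))"
  define S where "S = {i \<in> {..<g}. 2 * a i + 1 < t i}"
  define S' where "S' = {j \<in> {..<g}. 2 * ?a j + 1 < t j}"
  have sum: "(\<Sum>j<g. ?a j) = Suc (\<Sum>j<g. a j)"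
  proof -
    have "(\<Sum>j<g. ?a j) = ?a i + (\<Sum>j\<in>{..<g} - {i}. ?a j)"
      using assms by (intro sum.remove) auto
    also have "(\<Sum>j\<in>{..<g} - {i}. ?a j) = (\<Sum>j\<in>{..<g} - {i}. a j)" by (intro sum.cong) auto
    finally show ?thesis using assms sum.remove[of "{..<g}" i a] by simp
  qed
  have sub: "S' \<subseteq> S" "S \<subseteq> insert i S'" "finite S" "finite S'"
    by (auto simp: S_def S'_def split: if_splits)
  have "sun_number g S' \<le> sun_number g S" using sub by (intro sun_number_mono)
  moreover have "sun_number g S \<le> Suc (sun_number g S')"
    using sun_number_mono[OF sub(2)] sun_number_insert_le[OF sub(4)] sub(4)
    by (meson finite_insert le_trans)
  ultimately show "config_matching g t a \<le> config_matching g t ?a"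
    "config_matching g t ?a \<le> Suc (config_matching g t a)"
    unfolding config_matching_def sum S_def[symmetric] S'_def[symmetric] by simp_all
qed

lemma config_matching_decr:
  assumes "i < g" "0 < a i"
  shows "config_matching g t (a(i := a i - 1)) \<le> config_matching g t a"
    and "config_matching g t a \<le> Suc (config_matching g t (a(i := a i - 1)))"
  using config_matching_incr[OF assms(1), of t "a(i := a i - 1)"] assms(2) by simp_all

lemma sum_decr_less:
  fixes a :: "nat \<Rightarrow> nat"
  assumes "i < g" "0 < a i"
  shows "(\<Sum>j<g. (a(i := a i - 1)) j) < (\<Sum>j<g. a j)"
  using assms by (intro sum_strict_mono_ex1) auto

lemma config_matching_mono:
  "(\<And>i. i < g \<Longrightarrow> a i \<le> b i) \<Longrightarrow> config_matching g t a \<le> config_matching g t b"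
proof (induction "\<Sum>i<g. b i" arbitrary: b rule: less_induct)
  case less
  show ?case
  proof (cases "\<exists>i<g. a i < b i")
    case True
    then obtain i where i: "i < g" "a i < b i" by blast
    then have "config_matching g t a \<le> config_matching g t (b(i := b i - 1))"
      using less.prems by (intro less.hyps sum_decr_less) auto
    then show ?thesis using config_matching_decr(1)[of i g b t] i by linarith
  next
    case False
    then have "\<And>i. i < g \<Longrightarrow> a i = b i" using less.prems by (meson le_neq_implies_less)
    then show ?thesis using config_matching_cong[of g t t a b] by simp
  qed
qed

text \<open>A discrete intermediate value argument: lowering the entries of \<open>b\<close> to 0
  one unit at a time, the value never drops by more than one, so \<open>m\<close> is
  attained.\<close>

lemma config_matching_IVT:
  "config_matching g t (\<lambda>_. 0) \<le> m \<Longrightarrow> m \<le> config_matching g t b \<Longrightarrow>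
    \<exists>a. (\<forall>i<g. a i \<le> b i) \<and> config_matching g t a = m"
proof (induction "\<Sum>i<g. b i" arbitrary: b rule: less_induct)
  case less
  show ?case
  proof (cases "m = config_matching g t b")
    case False
    have "\<exists>i<g. 0 < b i"
    proof (rule ccontr)
      assume "\<not> (\<exists>i<g. 0 < b i)"
      then have "config_matching g t b = config_matching g t (\<lambda>_. 0)"
        by (intro config_matching_cong) auto
      with less.prems False show False by simp
    qed
    then obtain i where i: "i < g" "0 < b i" by blast
    then have "m \<le> config_matching g t (b(i := b i - 1))"
      using config_matching_decr(2)[of i g b t] less.prems(2) False by linarith
    then obtain a where a: "\<forall>j<g. a j \<le> (b(i := b i - 1)) j" "config_matching g t a = m"
      using less.hyps[OF sum_decr_less[of i g b]] less.prems(1) i by blast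
    have "a j \<le> b j" if "j < g" for j
      using a(1) that by (cases "j = i") (auto dest!: spec[of _ j])
    with a(2) show ?thesis by blast
  qed auto
qed

section \<open>Matchings of functional graphs\<close>

context rooted_cycle
begin

text \<open>Matchings as sets of vertices \<open>v\<close> standing for the edges \<open>{v, f v}\<close>.\<close>

definition "fmatch X \<longleftrightarrow> X \<subseteq> V \<and> inj_on f X \<and> X \<inter> f ` X = {}"

lemma inj_on_edge: "inj_on (\<lambda>v. {v, f v}) V"
proof (rule inj_onI)
  fix v w assume "v \<in> V" "w \<in> V" "{v, f v} = {w, f w}"
  then show "v = w" using f_f_neq[of v] by (auto simp: doubleton_eq_iff)
qed

lemma graph_edges_eq: "graph_edges G = (\<lambda>v. {v, f v}) ` V"
  by (auto simp: graph_edges_def)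

lemma matching_image_iff:
  assumes "X \<subseteq> V"
  shows "matching G ((\<lambda>v. {v, f v}) ` X) \<longleftrightarrow> fmatch X"
proof
  assume m: "matching G ((\<lambda>v. {v, f v}) ` X)"
  have d: "{v, f v} \<inter> {w, f w} = {}" if "v \<in> X" "w \<in> X" "v \<noteq> w" for v w
  proof -
    have "{v, f v} \<noteq> {w, f w}" using inj_on_edge that assms by (auto dest: inj_onD)
    then show ?thesis using m that(1,2) by (auto simp only: matching_def ball_simps)
  qed
  have "inj_on f X" using d by (intro inj_onI) blast
  moreover have "X \<inter> f ` X = {}"
  proof (rule ccontr)
    assume "X \<inter> f ` X \<noteq> {}"
    then obtain v where v: "v \<in> X" "f v \<in> X" by blast
    then show False using d[of v "f v"] f_neq[of v] assms by auto
  qed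
  ultimately show "fmatch X" using assms by (simp add: fmatch_def)
next
  assume X: "fmatch X"
  have "{v, f v} \<inter> {w, f w} = {}" if "v \<in> X" "w \<in> X" "{v, f v} \<noteq> {w, f w}" for v w
  proof -
    have "v \<noteq> w" using that by auto
    then have "f v \<noteq> f w" using X that by (auto simp: fmatch_def dest: inj_onD)
    moreover have "v \<noteq> f w" "w \<noteq> f v" using X that by (auto simp: fmatch_def)
    ultimately show ?thesis using \<open>v \<noteq> w\<close> by auto
  qed
  then show "matching G ((\<lambda>v. {v, f v}) ` X)"
    unfolding matching_def graph_edges_eq using assms by blast
qed

lemma matching_number_eq_Max: "matching_number G = Max (card ` {X. fmatch X})"
proof -
  let ?e = "image (\<lambda>v. {v, f v})"
  have M: "{M. matching G M} = ?e ` {X. fmatch X}"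
  proof (intro subset_antisym subsetI)
    fix M assume M: "M \<in> {M. matching G M}"
    then have "M \<subseteq> ?e V" by (simp add: matching_def graph_edges_eq)
    then obtain X where "X \<subseteq> V" "M = ?e X" by (meson subset_imageE)
    then show "M \<in> ?e ` {X. fmatch X}" using M matching_image_iff by blast
  next
    fix M assume "M \<in> ?e ` {X. fmatch X}"
    then obtain X where "fmatch X" "M = ?e X" by blast
    then show "M \<in> {M. matching G M}" using matching_image_iff[of X] by (simp add: fmatch_def)
  qed
  have "card (?e X) = card X" if "fmatch X" for X
    using that inj_on_subset[OF inj_on_edge, of X] by (auto simp: fmatch_def intro: card_image)
  then have "card ` {M. matching G M} = card ` {X. fmatch X}"
    unfolding M by (auto simp: image_iff)
  then show ?thesis by (simp add: matching_number_def)
qed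

lemma finite_fmatch: "finite {X. fmatch X}"
  by (rule finite_subset[of _ "Pow V"]) (use fin in \<open>auto simp: fmatch_def\<close>)

lemma matching_number_ge: "fmatch X \<Longrightarrow> card X \<le> matching_number G"
  unfolding matching_number_eq_Max using finite_fmatch by (intro Max_ge) auto

lemma matching_number_attained: obtains X where "fmatch X" "card X = matching_number G"
proof -
  have "fmatch {}" by (simp add: fmatch_def)
  then have "matching_number G \<in> card ` {X. fmatch X}"
    unfolding matching_number_eq_Max using finite_fmatch by (intro Max_in) auto
  then show thesis using that by auto
qed

lemma f_eq_u: "v \<in> off \<Longrightarrow> f v \<notin> off \<Longrightarrow> f v = u (ix v)"
  using offD(2,3) ix_u by (metis V_cases)

text \<open>Sort the edges of a maximum matching: \<open>A i\<close> lies in branch \<open>i\<close>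
  away from its root, \<open>B\<close> joins roots to their branches, \<open>Y\<close> marks the
  cycle edges. The edges of \<open>A i\<close> act as paths; \<open>B\<close> and \<open>Y\<close>
  form a matching of the cycle with pendant edges.\<close>

lemma matching_number_le_config:
  obtains a where "\<And>i. i < g \<Longrightarrow> a i \<le> binner i" "\<And>i. i < g \<Longrightarrow> 2 * a i < bsize i"
    "matching_number G \<le> config_matching g bsize a"
proof -
  obtain X where X: "fmatch X" "card X = matching_number G" by (rule matching_number_attained)
  then have XV: "X \<subseteq> V" and inj: "inj_on f X" and disj: "X \<inter> f ` X = {}"
    by (auto simp: fmatch_def)
  have finX: "finite X" using XV fin by (rule finite_subset)
  define A where "A i = {v \<in> X. v \<in> off \<and> f v \<in> off \<and> ix v = i}" for i
  define B where "B = {v \<in> X. v \<in> off \<and> f v \<notin> off}"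
  define P where "P = ix ` B"
  define Y where "Y = {i \<in> {..<g}. u i \<in> X}"
  have finA: "finite (A i)" for i using finX by (simp add: A_def)
  have fA: "card (f ` A i) = card (A i)" for i
    by (rule card_image) (rule inj_on_subset[OF inj], auto simp: A_def)
  have disjA: "A i \<inter> f ` A i = {}" for i using disj by (auto simp: A_def)
  have binner: "card (A i) \<le> binner i" for i
  proof -
    have "f ` A i \<subseteq> {v \<in> inner. ix v = i}" by (auto simp: A_def inner_def offD(3))
    then show ?thesis
      unfolding binner_def fA[of i, symmetric] using finite_inner by (intro card_mono) auto
  qed
  \<comment> \<open>The root, both ends of the edges in \<open>A i\<close>, and \<open>Z\<close> are
    pairwise disjoint. \<open>Z\<close> will be empty, or the outer end of the edge matching the
    root into its branch; the latter shows that \<open>i\<close> may carry a pendant edge of the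
    sun.\<close>
  have count: "2 * card (A i) + card Z < bsize i"
    if "i < g" "Z \<subseteq> {v \<in> B. ix v = i}" for i Z
  proof -
    have Z: "Z \<inter> (A i \<union> f ` A i) = {}" "finite Z" "u i \<notin> Z"
      using that disj finX u_notin_off by (auto simp: A_def B_def intro: finite_subset)
    have ui: "u i \<notin> A i \<union> f ` A i" using u_notin_off[OF that(1)] by (auto simp: A_def)
    have "insert (u i) (Z \<union> (A i \<union> f ` A i)) \<subseteq> {x \<in> V. ix x = i}"
      using that XV u_in ix_u by (auto simp: A_def B_def offD)
    then have "card (insert (u i) (Z \<union> (A i \<union> f ` A i))) \<le> bsize i"
      unfolding bsize_def using fin by (intro card_mono) auto
    moreover have "card (insert (u i) (Z \<union> (A i \<union> f ` A i))) = Suc (card Z + (card (A i) + card (A i)))"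
      using Z ui finA[of i] disjA[of i] fA[of i] by (simp add: card_Un_disjoint)
    ultimately show ?thesis by simp
  qed
  have size: "2 * card (A i) < bsize i" if "i < g" for i
    using count[OF that, of "{}"] by simp
  have B_root: "f v = u (ix v)" "ix v < g" if "v \<in> B" for v
    using that f_eq_u offD(5) by (auto simp: B_def)
  have inj_ix: "inj_on ix B"
  proof (rule inj_onI)
    fix v w assume "v \<in> B" "w \<in> B" "ix v = ix w"
    then have "f v = f w" using B_root by simp
    then show "v = w" using inj \<open>v \<in> B\<close> \<open>w \<in> B\<close> by (auto simp: B_def dest: inj_onD)
  qed
  have P_sub: "P \<subseteq> {i \<in> {..<g}. 2 * card (A i) + 1 < bsize i}"
  proof
    fix i assume "i \<in> P"
    then obtain v where v: "v \<in> B" "i = ix v" by (auto simp: P_def)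
    then show "i \<in> {i \<in> {..<g}. 2 * card (A i) + 1 < bsize i}"
      using count[of i "{v}"] B_root by auto
  qed
  have "(Y, P) \<in> sun_matchings g {i \<in> {..<g}. 2 * card (A i) + 1 < bsize i}"
  proof -
    have "i \<notin> P" if "i \<in> Y" for i
    proof
      assume "i \<in> P"
      then obtain v where "v \<in> B" "u i = f v" using B_root by (auto simp: P_def)
      then show False using that disj by (auto simp: Y_def B_def)
    qed
    moreover have "Suc i mod g \<notin> Y" if "i \<in> Y" for i
      using that disj f_u by (force simp: Y_def)
    moreover have "Suc i mod g \<notin> P" if "i \<in> Y" for i
    proof
      assume "Suc i mod g \<in> P"
      then obtain v where v: "v \<in> B" "f v = u (Suc i mod g)" using B_root by (auto simp: P_def)
      then have "f v = f (u i)" using that f_u by (simp add: Y_def)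
      then have "v = u i" using inj v that by (auto simp: B_def Y_def dest: inj_onD)
      then show False using v that u_notin_off by (auto simp: B_def Y_def)
    qed
    ultimately show ?thesis using P_sub by (auto simp: sun_matchings_def Y_def)
  qed
  then have "card Y + card P \<le> sun_number g {i \<in> {..<g}. 2 * card (A i) + 1 < bsize i}"
    by (intro sun_number_ge) auto
  moreover have "card X = (\<Sum>i<g. card (A i)) + (card Y + card P)"
  proof -
    have "card (\<Union>i<g. A i) = (\<Sum>i<g. card (A i))"
      using finA by (intro card_UN_disjoint) (auto simp: A_def)
    moreover have "X = (\<Union>i<g. A i) \<union> (u ` Y \<union> B)"
    proof (intro subset_antisym subsetI)
      fix x assume "x \<in> X"
      then have "x \<in> V" using XV by blast
      then show "x \<in> (\<Union>i<g. A i) \<union> (u ` Y \<union> B)"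
      proof (cases rule: V_cases)
        case (cyc i)
        then show ?thesis using \<open>x \<in> X\<close> by (auto simp: Y_def)
      next
        case off
        then show ?thesis using \<open>x \<in> X\<close> offD(5) by (auto simp: A_def B_def)
      qed
    qed (auto simp: A_def B_def Y_def)
    moreover have "(\<Union>i<g. A i) \<inter> (u ` Y \<union> B) = {}" "u ` Y \<inter> B = {}"
      using u_notin_off by (auto simp: A_def B_def Y_def)
    moreover have "card (u ` Y) = card Y"
      by (rule card_image) (rule inj_on_subset[OF inj_u], auto simp: Y_def)
    moreover have "card B = card P" unfolding P_def using inj_ix by (simp add: card_image)
    moreover have "finite (\<Union>i<g. A i)" "finite (u ` Y)" "finite B"
      using finA finX by (auto simp: Y_def B_def)
    ultimately show ?thesis by (metis card_Un_disjoint finite_Un)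
  qed
  ultimately show thesis
    using that[of "\<lambda>i. card (A i)"] binner size X(2) by (simp add: config_matching_def)
qed

text \<open>Edges avoiding the cycle are combined with an optimal matching of the sun, whose pendant
  edge at \<open>i\<close> is realised by \<open>c i\<close>. The condition on \<open>c i\<close>
  keeps the two parts disjoint.\<close>

lemma matching_number_ge_sun:
  assumes A: "\<And>v. v \<in> A \<Longrightarrow> v \<in> off \<and> f v \<in> off" "inj_on f A" "A \<inter> f ` A = {}"
    and S: "S \<subseteq> {..<g}" "\<And>i. i \<in> S \<Longrightarrow> c i \<in> off \<and> f (c i) = u i \<and> c i \<notin> A \<union> f ` A"
  shows "card A + sun_number g S \<le> matching_number G"
proof -
  have "finite S" using S(1) by (rule finite_subset) simp
  then obtain Y P where YP: "(Y, P) \<in> sun_matchings g S" "card Y + card P = sun_number g S"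
    by (rule sun_number_attained)
  then have Y: "Y \<subseteq> {..<g}" and P: "P \<subseteq> S" "P \<subseteq> {..<g}" and YP0: "Y \<inter> P = {}"
    "\<And>i. i \<in> Y \<Longrightarrow> Suc i mod g \<notin> Y" "\<And>i. i \<in> Y \<Longrightarrow> Suc i mod g \<notin> P"
    using S(1) by (auto simp: sun_matchings_def)
  have cP: "c i \<in> off" "f (c i) = u i" "c i \<notin> A" "c i \<notin> f ` A" "i < g" if "i \<in> P" for i
    using S(2)[of i] that P by auto
  have uY: "f (u i) = u (Suc i mod g)" "i < g" if "i \<in> Y" for i
    using that Y f_u by auto
  have u_eq: "u i = u j \<longleftrightarrow> i = j" if "i < g" "j < g" for i j
    using that ix_u by metis
  have u_off: "u i \<noteq> x" if "i < g" "x \<in> off" for i x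
    using that u_notin_off by blast
  have injc: "inj_on c P" using cP(2,5) u_eq by (metis inj_onI)
  have injuY: "inj_on u Y" using Y by (rule inj_on_subset[OF inj_u])
  have sub: "A \<subseteq> off" "f ` A \<subseteq> off" "c ` P \<subseteq> off" "u ` Y \<inter> off = {}"
    using A(1) cP(1) uY(2) u_notin_off by auto
  have cA: "c ` P \<inter> A = {}" "c ` P \<inter> f ` A = {}" using cP(3,4) by auto
  have disj: "A \<inter> (c ` P \<union> u ` Y) = {}" "c ` P \<inter> u ` Y = {}"
    using sub cA(1) by blast+
  have Suc_inj: "Suc i mod g = Suc j mod g \<longleftrightarrow> i = j" if "i < g" "j < g" for i j
    using that by (auto simp: Suc_mod_eq)
  have injf: "inj_on f (c ` P \<union> u ` Y)"
    unfolding inj_on_Un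
  proof (intro conjI)
    show "inj_on f (c ` P)" using cP(2,5) u_eq by (auto intro!: inj_onI)
    show "inj_on f (u ` Y)"
    proof (intro inj_onI)
      fix x y assume "x \<in> u ` Y" "y \<in> u ` Y" "f x = f y"
      then obtain i j where "x = u i" "y = u j" "i \<in> Y" "j \<in> Y" "u (Suc i mod g) = u (Suc j mod g)"
        using uY by auto
      then show "x = y" using u_eq Suc_mod_less Suc_inj uY(2) by metis
    qed
    have "u i \<noteq> u (Suc j mod g)" if "i \<in> P" "j \<in> Y" for i j
      using that u_eq Suc_mod_less cP(5) YP0(3) by metis
    then show "f ` (c ` P - u ` Y) \<inter> f ` (u ` Y - c ` P) = {}"
      using cP(2) uY(1) by fastforce
  qed
  have f_img: "f ` (c ` P \<union> u ` Y) \<subseteq> u ` {..<g}"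
    using cP(2,5) uY Suc_mod_less by auto
  have "fmatch (A \<union> (c ` P \<union> u ` Y))"
    unfolding fmatch_def
  proof (intro conjI)
    have "off \<subseteq> V" using offD(1) by blast
    moreover have "u ` Y \<subseteq> V" using uY(2) u_in by auto
    ultimately show "A \<union> (c ` P \<union> u ` Y) \<subseteq> V" using sub(1,3) by blast
    have "u ` {..<g} \<inter> off = {}" using u_notin_off by auto
    then have "f ` A \<inter> f ` (c ` P \<union> u ` Y) = {}" using sub(2) f_img by blast
    then have "f ` (A - (c ` P \<union> u ` Y)) \<inter> f ` ((c ` P \<union> u ` Y) - A) = {}" by blast
    then show "inj_on f (A \<union> (c ` P \<union> u ` Y))"
      unfolding inj_on_Un[of f A] using A(2) injf by simp
    have "x \<notin> f ` (c ` P \<union> u ` Y)" if "x \<in> A \<union> (c ` P \<union> u ` Y)" for x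
    proof
      assume x: "x \<in> f ` (c ` P \<union> u ` Y)"
      then obtain j where "j < g" "x = u j" using f_img by blast
      then have "x \<notin> off" using u_notin_off by simp
      then have "x \<in> u ` Y" using that sub(1,3) by blast
      then obtain j where j: "j \<in> Y" "x = u j" by blast
      from x consider i where "i \<in> P" "x = u i" | i where "i \<in> Y" "x = u (Suc i mod g)"
        using cP(2) uY(1) by auto
      then show False
        using j u_eq uY(2) cP(5) Suc_mod_less YP0 by cases (metis disjoint_iff, metis)
    qed
    then have "(A \<union> (c ` P \<union> u ` Y)) \<inter> f ` (c ` P \<union> u ` Y) = {}"
      by (intro disjoint_iff[THEN iffD2] allI impI)
    moreover have "(A \<union> (c ` P \<union> u ` Y)) \<inter> f ` A = {}"
      using A(3) cA(2) sub(2,4) by blast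
    ultimately show "(A \<union> (c ` P \<union> u ` Y)) \<inter> f ` (A \<union> (c ` P \<union> u ` Y)) = {}"
      unfolding image_Un[of f A] Int_Un_distrib by simp
  qed
  moreover have "card (A \<union> (c ` P \<union> u ` Y)) = card A + (card P + card Y)"
  proof -
    have "finite A" using A(1) finite_off by (meson finite_subset subsetI)
    moreover have "finite P" "finite Y" using P(2) Y by (auto intro: finite_subset)
    ultimately show ?thesis
      using disj by (simp add: card_Un_disjoint card_image injc injuY)
  qed
  ultimately show ?thesis using matching_number_ge YP(2) by fastforce
qed

text \<open>The lower end for the intermediate value argument: in a branch with more than one vertex
  the root has a child, so the sun embeds into \<open>G\<close>.\<close>

lemma config_matching_0_le: "config_matching g bsize (\<lambda>_. 0) \<le> matching_number G"
proof -
  have "\<exists>z. z \<in> off \<and> f z = u i" if i: "i < g" "1 < bsize i" for i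
  proof -
    have "\<not> {x \<in> V. ix x = i} \<subseteq> {u i}"
      using i(2) card_mono[of "{u i}" "{x \<in> V. ix x = i}"] by (auto simp: bsize_def)
    then obtain x where "x \<in> V" "ix x = i" "x \<noteq> u i" by blast
    then show ?thesis using ex_child_in_anc[of x "u i"] i u_in ix_u by auto
  qed
  then obtain c where "\<And>i. i < g \<Longrightarrow> 1 < bsize i \<Longrightarrow> c i \<in> off \<and> f (c i) = u i" by metis
  then have "card ({} :: 'a set) + sun_number g {i \<in> {..<g}. 1 < bsize i} \<le> matching_number G"
    by (intro matching_number_ge_sun[of _ _ c]) auto
  then show ?thesis by (simp add: config_matching_def)
qed

end

text \<open>\<open>below v = 2\<close> for inner \<open>v\<close> says that all branches are trees \<open>T\<^sup>*\<close>: besides the root \<open>u i\<close>, the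
  \<open>i\<close>-th one consists of the pairs \<open>{f v, v}\<close> with \<open>v\<close> in \<open>tips\<close>, and of pendant vertices \<open>stubs\<close>.\<close>

locale spider_cycle = rooted_cycle +
  assumes below_inner: "v \<in> inner \<Longrightarrow> below v = 2"
begin

definition "tips = {v \<in> off. f v \<in> off}"

lemma f_tips: "f ` tips = inner"
  by (auto simp: tips_def inner_def)

text \<open>\<open>f v\<close> and \<open>v\<close> both lie beyond the edge of \<open>f v\<close>,
  and \<open>below_inner\<close> leaves room for nothing else.\<close>

lemma below_eq_pair:
  assumes "v \<in> tips"
  shows "{x \<in> V. f v \<in> anc x} = {f v, v}"
proof -
  have v: "v \<in> off" "f v \<in> off" "f v \<in> inner" using assms f_tips by (auto simp: tips_def)
  have "{f v, v} \<subseteq> {x \<in> V. f v \<in> anc x}"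
    using v self_in_anc anc_step[of v] offD(1) by auto
  moreover have "card {f v, v} = card {x \<in> V. f v \<in> anc x}"
    using below_inner[OF v(3)] f_neq[of v] offD(1)[OF v(1)] by (simp add: below_def)
  moreover have "finite {x \<in> V. f v \<in> anc x}" using fin by simp
  ultimately show ?thesis using card_subset_eq by metis
qed

lemma inj_on_f_tips: "inj_on f tips"
proof (rule inj_onI)
  fix v w assume vw: "v \<in> tips" "w \<in> tips" "f v = f w"
  then have "{f v, v} = {f v, w}" using below_eq_pair[of v] below_eq_pair[of w] by simp
  then show "v = w" by (auto simp: doubleton_eq_iff)
qed

lemma tips_inner_disjoint: "tips \<inter> inner = {}"
proof (rule ccontr)
  assume "tips \<inter> inner \<noteq> {}"
  then have "tips \<inter> f ` tips \<noteq> {}" using f_tips by simp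
  then obtain w where w: "w \<in> tips" "f w \<in> tips" by blast
  then have "f (f w) \<in> anc w" "w \<in> V"
    using anc_step self_in_anc offD(1) by (auto simp: tips_def)
  then have "w \<in> {f (f w), f w}" using below_eq_pair[OF w(2)] by blast
  then show False using f_neq f_f_neq \<open>w \<in> V\<close> by force
qed

lemma card_tips_ix: "card {v \<in> tips. ix v = i} = binner i"
proof -
  have "f ` {v \<in> tips. ix v = i} = {v \<in> inner. ix v = i}"
    unfolding f_tips[symmetric] by (auto simp: tips_def offD(3))
  then show ?thesis
    unfolding binner_def using card_image[OF inj_on_subset[OF inj_on_f_tips]]
    by (metis (no_types, lifting) mem_Collect_eq subsetI)
qed

definition "stubs = {v \<in> off. v \<notin> tips \<and> v \<notin> inner}"

lemma f_stub: "v \<in> stubs \<Longrightarrow> f v = u (ix v)"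
  using f_eq_u by (auto simp: stubs_def tips_def)

lemma bsize_eq:
  assumes "i < g"
  shows "bsize i = 1 + 2 * binner i + card {v \<in> stubs. ix v = i}"
proof -
  have fin': "finite tips" "finite stubs" using finite_off by (auto simp: tips_def stubs_def)
  have "{x \<in> V. ix x = i} = insert (u i) ({v \<in> tips. ix v = i} \<union>
    ({v \<in> inner. ix v = i} \<union> {v \<in> stubs. ix v = i}))"
  proof (intro subset_antisym subsetI)
    fix x assume "x \<in> {x \<in> V. ix x = i}"
    then have "x \<in> V" "ix x = i" by auto
    then show "x \<in> insert (u i) ({v \<in> tips. ix v = i} \<union>
      ({v \<in> inner. ix v = i} \<union> {v \<in> stubs. ix v = i}))"
      by (cases rule: V_cases) (auto simp: ix_u stubs_def)
  next
    fix x assume "x \<in> insert (u i) ({v \<in> tips. ix v = i} \<union>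
      ({v \<in> inner. ix v = i} \<union> {v \<in> stubs. ix v = i}))"
    then have "x = u i \<or> x \<in> off \<and> ix x = i" by (auto simp: tips_def inner_def stubs_def)
    then show "x \<in> {x \<in> V. ix x = i}" using u_in[OF assms] ix_u[OF assms] offD(1) by auto
  qed
  moreover have "u i \<notin> {v \<in> tips. ix v = i} \<union> ({v \<in> inner. ix v = i} \<union> {v \<in> stubs. ix v = i})"
    using u_notin_off[OF assms] by (auto simp: tips_def inner_def stubs_def)
  moreover have "{v \<in> tips. ix v = i} \<inter> ({v \<in> inner. ix v = i} \<union> {v \<in> stubs. ix v = i}) = {}"
    "{v \<in> inner. ix v = i} \<inter> {v \<in> stubs. ix v = i} = {}"
    using tips_inner_disjoint by (auto simp: stubs_def)
  ultimately show ?thesis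
    using fin' finite_inner card_tips_ix[of i]
    by (simp add: bsize_def card_Un_disjoint binner_def)
qed

text \<open>For \<open>\<le>\<close>, the configuration extracted from a maximum matching has at
  most \<open>binner i\<close> paths, and \<open>config_matching\<close> is monotone. For
  \<open>\<ge>\<close>, the edges of all tips are combined with a sun matching;
  \<open>2 * binner i + 1 < bsize i\<close> means that branch \<open>i\<close> has a stub.\<close>

lemma matching_number_eq_config: "matching_number G = config_matching g bsize binner"
proof (rule antisym)
  obtain a where "\<And>i. i < g \<Longrightarrow> a i \<le> binner i" "matching_number G \<le> config_matching g bsize a"
    using matching_number_le_config by metis
  then show "matching_number G \<le> config_matching g bsize binner"
    using config_matching_mono[of g a binner bsize] by (meson le_trans)
next
  let ?S = "{i \<in> {..<g}. 2 * binner i + 1 < bsize i}"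
  have "\<forall>i\<in>?S. \<exists>v. v \<in> off \<and> f v = u i \<and> v \<notin> tips \<union> f ` tips"
  proof
    fix i assume "i \<in> ?S"
    then have "card {v \<in> stubs. ix v = i} \<noteq> 0" using bsize_eq[of i] by auto
    then have "{v \<in> stubs. ix v = i} \<noteq> {}" by (metis card.empty)
    then obtain v where "v \<in> stubs" "ix v = i" by blast
    then have "v \<in> off \<and> f v = u i \<and> v \<notin> tips \<union> f ` tips"
      using f_stub[of v] unfolding f_tips by (simp add: stubs_def)
    then show "\<exists>v. v \<in> off \<and> f v = u i \<and> v \<notin> tips \<union> f ` tips" by blast
  qed
  then obtain c where c: "\<forall>i\<in>?S. c i \<in> off \<and> f (c i) = u i \<and> c i \<notin> tips \<union> f ` tips"
    by (rule bchoice[THEN exE])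
  have "card tips + sun_number g ?S \<le> matching_number G"
  proof (rule matching_number_ge_sun)
    show "c i \<in> off \<and> f (c i) = u i \<and> c i \<notin> tips \<union> f ` tips" if "i \<in> ?S" for i
      using c that by (rule bspec)
    show "tips \<inter> f ` tips = {}" using tips_inner_disjoint f_tips by simp
  qed (use inj_on_f_tips in \<open>auto simp: tips_def\<close>)
  moreover have "card tips = (\<Sum>i<g. binner i)"
    using card_image[OF inj_on_f_tips] f_tips sum_binner by simp
  ultimately show "config_matching g bsize binner \<le> matching_number G"
    by (simp add: config_matching_def)
qed

lemma double_wiener_eq_config: "2 * wiener_index G = config_cost g bsize (\<Sum>i<g. binner i)"
  using double_wiener_eq_cost below_inner sum_binner by simp

end

section \<open>Concentrating the large branches\<close>

text \<open>Two vertices per path and one for the root; the rest of the order is available for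
  pendant edges.\<close>

definition valid_config :: "nat \<Rightarrow> (nat \<Rightarrow> nat) \<Rightarrow> (nat \<Rightarrow> nat) \<Rightarrow> bool" where
  "valid_config g t a \<longleftrightarrow> (\<forall>i<g. 2 * a i < t i)"

text \<open>Half the partial derivative of the quadratic form with respect to \<open>t k\<close>,
  hence the quantity deciding in which direction to move vertices.\<close>

definition transmission :: "nat \<Rightarrow> (nat \<Rightarrow> nat) \<Rightarrow> nat \<Rightarrow> nat" where
  "transmission g t k = (\<Sum>l<g. t l * cyc_dist g k l)"

lemma sum_fun_upd:
  fixes F :: "nat \<Rightarrow> nat"
  assumes "i < g"
  shows "(\<Sum>k<g. (F(i := y)) k) + F i = (\<Sum>k<g. F k) + y"
proof -
  have "(\<Sum>k<g. (F(i := y)) k) = y + (\<Sum>k\<in>{..<g} - {i}. (F(i := y)) k)"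
    using assms by (subst sum.remove[of _ i]) auto
  moreover have "(\<Sum>k\<in>{..<g} - {i}. (F(i := y)) k) = (\<Sum>k\<in>{..<g} - {i}. F k)"
    by (rule sum.cong) auto
  moreover have "(\<Sum>k<g. F k) = F i + (\<Sum>k\<in>{..<g} - {i}. F k)"
    using assms by (intro sum.remove) auto
  ultimately show ?thesis by simp
qed

lemma sum_transfer:
  fixes F :: "nat \<Rightarrow> nat"
  assumes "i < g" "j < g" "i \<noteq> j" "x \<le> F i"
  shows "(\<Sum>k<g. (F(i := F i - x, j := F j + x)) k) = (\<Sum>k<g. F k)"
  using sum_fun_upd[OF assms(1), of F "F i - x"]
    sum_fun_upd[OF assms(2), of "F(i := F i - x)" "F j + x"] assms by simp

text \<open>The change of the quadratic form along \<open>x\<close> times \<open>e\<^sub>j - e\<^sub>i\<close> is \<open>2 * x\<close> times the difference of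
  the transmissions minus \<open>2 * x\<^sup>2\<close> times the distance of \<open>i\<close> and \<open>j\<close>, so moving vertices
  towards the smaller transmission pays off.\<close>

lemma transfer_decreases:
  fixes t :: "nat \<Rightarrow> nat"
  assumes ij: "i < g" "j < g" "i \<noteq> j" and x: "0 < x" "x \<le> t i"
    and D: "transmission g t j \<le> transmission g t i"
  shows "(\<Sum>k<g. \<Sum>l<g. (t(i := t i - x, j := t j + x)) k * (t(i := t i - x, j := t j + x)) l *
      cyc_dist g k l) < (\<Sum>k<g. \<Sum>l<g. t k * t l * cyc_dist g k l)"
proof -
  let ?t = "t(i := t i - x, j := t j + x)"
  define d where "d k = (if k = j then int x else if k = i then - int x else 0)" for k
  define c where "c k l = int (cyc_dist g k l)" for k l
  have t': "int (?t k) = int (t k) + d k" for k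
    using ij x by (auto simp: d_def)
  have sum_d: "(\<Sum>k<g. d k * F k) = int x * F j - int x * F i" for F :: "nat \<Rightarrow> int"
  proof -
    have "d k * F k = (if k = j then int x * F j else 0) - (if k = i then int x * F i else 0)" for k
      using ij by (auto simp: d_def)
    then show ?thesis using ij by (simp add: sum_subtractf)
  qed
  have c_sym: "c k l = c l k" for k l by (simp add: c_def cyc_dist_commute)
  have tr: "(\<Sum>l<g. int (t l) * c k l) = int (transmission g t k)" for k
    by (simp add: transmission_def c_def)
  have exp: "int (?t k) * int (?t l) * c k l = int (t k) * int (t l) * c k l +
      d k * (int (t l) * c k l) + d l * (int (t k) * c l k) + d k * (d l * c k l)" for k l
    unfolding t' using c_sym[of k l] by (simp add: algebra_simps)
  have swap: "(\<Sum>k<g. \<Sum>l<g. d l * (int (t k) * c l k)) =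
      (\<Sum>l<g. d l * (\<Sum>k<g. int (t k) * c l k))"
    by (subst sum.swap) (simp add: sum_distrib_left)
  have "(\<Sum>k<g. \<Sum>l<g. int (?t k) * int (?t l) * c k l) =
    (\<Sum>k<g. \<Sum>l<g. int (t k) * int (t l) * c k l) +
    (\<Sum>k<g. d k * (\<Sum>l<g. int (t l) * c k l)) +
    (\<Sum>l<g. d l * (\<Sum>k<g. int (t k) * c l k)) +
    (\<Sum>k<g. d k * (\<Sum>l<g. d l * c k l))"
    unfolding exp sum.distrib swap by (simp add: sum_distrib_left)
  also have "\<dots> = (\<Sum>k<g. \<Sum>l<g. int (t k) * int (t l) * c k l) +
      2 * (int x * (int (transmission g t j) - int (transmission g t i))) - 2 * (int x * int x * c i j)"
    unfolding tr sum_d using c_sym[of i j] by (simp add: c_def algebra_simps)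
  also have "\<dots> < (\<Sum>k<g. \<Sum>l<g. int (t k) * int (t l) * c k l)"
  proof -
    have "0 < int x * int x * c i j" using cyc_dist_pos[OF ij] x by (simp add: c_def)
    moreover have "int x * (int (transmission g t j) - int (transmission g t i)) \<le> 0"
      using D by (simp add: mult_nonneg_nonpos)
    ultimately show ?thesis by linarith
  qed
  finally have "int (\<Sum>k<g. \<Sum>l<g. ?t k * ?t l * cyc_dist g k l) <
      int (\<Sum>k<g. \<Sum>l<g. t k * t l * cyc_dist g k l)"
    unfolding c_def by (simp only: of_nat_sum of_nat_mult)
  then show ?thesis by (simp only: of_nat_less_iff)
qed

lemma config_cost_transfer:
  assumes "i < g" "j < g" "i \<noteq> j" "0 < x" "x \<le> t i"
    and "transmission g t j \<le> transmission g t i"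
  shows "config_cost g (t(i := t i - x, j := t j + x)) N < config_cost g t N"
  unfolding config_cost_def sum_transfer[where F = t, OF assms(1-3,5)]
  using transfer_decreases[OF assms] by simp

lemma config_cost_mono:
  "N \<le> M \<Longrightarrow> config_cost g t N \<le> config_cost g t M"
  by (simp add: config_cost_def mult_le_mono)

lemma config_cost_strict_mono:
  assumes "N < M" "3 < (\<Sum>i<g. t i)"
  shows "config_cost g t N < config_cost g t M"
proof -
  have "N * ((\<Sum>i<g. t i) - 3) < M * ((\<Sum>i<g. t i) - 3)" using assms by simp
  then show ?thesis by (simp add: config_cost_def)
qed

lemma improve_config_directed:
  assumes valid: "valid_config g t a" and ij: "i < g" "j < g" "i \<noteq> j" "2 < t i" "2 < t j"
    and D: "transmission g t j \<le> transmission g t i"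
  shows "\<exists>t' a'. valid_config g t' a' \<and> (\<Sum>k<g. t' k) = (\<Sum>k<g. t k) \<and>
    config_matching g t' a' = config_matching g t a \<and>
    config_cost g t' (\<Sum>k<g. a' k) < config_cost g t (\<Sum>k<g. a k)"
proof -
  define S where "S = {k \<in> {..<g}. 2 * a k + 1 < t k}"
  have v: "2 * a k < t k" if "k < g" for k using valid that by (simp add: valid_config_def)
  show ?thesis
  proof (cases "0 < a i")
    case True
    \<comment> \<open>A whole path moves: \<open>t\<close> changes by 2 and \<open>a\<close> by 1,
      so the condition defining \<open>S\<close> is unaffected at \<open>i\<close> and
      \<open>j\<close>.\<close>
    let ?t = "t(i := t i - 2, j := t j + 2)" and ?a = "a(i := a i - 1, j := a j + 1)"
    have "2 * (a i - 1) < t i - 2" using v[OF ij(1)] True by linarith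
    then have "valid_config g ?t ?a"
      unfolding valid_config_def using v ij by auto
    moreover have "{k \<in> {..<g}. 2 * ?a k + 1 < ?t k} = S"
      using True ij v[OF ij(1)] unfolding S_def by auto
    moreover have "(\<Sum>k<g. ?a k) = (\<Sum>k<g. a k)"
      using True ij by (intro sum_transfer) auto
    moreover have "(\<Sum>k<g. ?t k) = (\<Sum>k<g. t k)"
      using ij by (intro sum_transfer) auto
    ultimately show ?thesis
      using config_cost_transfer[of i g j 2 t "\<Sum>k<g. a k"] ij D
      by (intro exI[of _ ?t] exI[of _ ?a]) (simp add: config_matching_def S_def)
  next
    case ai: False
    let ?t = "t(i := t i - 1, j := t j + 1)"
    have t': "valid_config g ?t a"
      using v ai ij by (auto simp: valid_config_def intro: less_SucI)
    have sum_t: "(\<Sum>k<g. ?t k) = (\<Sum>k<g. t k)"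
      using ij by (intro sum_transfer) auto
    have cost: "config_cost g ?t (\<Sum>k<g. a k) < config_cost g t (\<Sum>k<g. a k)"
      using ij D by (intro config_cost_transfer) auto
    \<comment> \<open>Without paths, branch \<open>i\<close> has at least two pendant edges because
      \<open>2 < t i\<close>, so one is left and \<open>i\<close> stays in \<open>S\<close>. Branch
      \<open>j\<close> has one afterwards in any case.\<close>
    have S': "{k \<in> {..<g}. 2 * a k + 1 < ?t k} = insert j S"
      using ai ij v[OF ij(2)] unfolding S_def by auto
    have finS: "finite S" by (simp add: S_def)
    show ?thesis
    proof (cases "sun_number g (insert j S) = sun_number g S")
      case True
      then have "config_matching g ?t a = config_matching g t a"
        unfolding config_matching_def S' by (simp add: S_def)
      then show ?thesis using t' sum_t cost by blast
    next
      case False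
      \<comment> \<open>Branch \<open>j\<close> has no pendant edge, so \<open>t j > 2\<close>
        yields a path to split. Splitting it enlarges \<open>S\<close> by \<open>j\<close> at
        unchanged orders: the sun number gained makes up for the path lost, and the cost
        falls.\<close>
      then have "j \<notin> S" by (metis insert_absorb)
      then have tj: "t j = 2 * a j + 1" using v[OF ij(2)] ij(2) by (simp add: S_def)
      have num: "sun_number g (insert j S) = Suc (sun_number g S)"
        using False sun_number_insert_le[OF finS, of g j]
          sun_number_mono[of S "insert j S" g] finS by fastforce
      let ?a = "a(j := a j - 1)"
      have "0 < a j" using tj ij by simp
      have "2 * (a j - 1) < t j" using v[OF ij(2)] by linarith
      then have "valid_config g t ?a" using v by (auto simp: valid_config_def)
      moreover have "{k \<in> {..<g}. 2 * ?a k + 1 < t k} = insert j S"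
        using tj ij unfolding S_def by auto
      moreover have sum: "(\<Sum>k<g. a k) = Suc (\<Sum>k<g. ?a k)"
        using sum_fun_upd[OF ij(2), of a "a j - 1"] \<open>0 < a j\<close> by simp
      ultimately have "config_matching g t ?a = config_matching g t a"
        unfolding config_matching_def using num by (simp add: S_def)
      \<comment> \<open>A path costs \<open>n - 3\<close>, so strictness requires
        \<open>n > 3\<close>.\<close>
      moreover have "t i + t j \<le> (\<Sum>k<g. t k)"
        using ij sum_mono2[of "{..<g}" "{i, j}" t] by simp
      then have "config_cost g t (\<Sum>k<g. ?a k) < config_cost g t (\<Sum>k<g. a k)"
        using ij sum by (intro config_cost_strict_mono) auto
      ultimately show ?thesis using \<open>valid_config g t ?a\<close> by blast
    qed
  qed
qed

lemma improve_config:
  assumes "valid_config g t a" "i < g" "j < g" "i \<noteq> j" "2 < t i" "2 < t j"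
  shows "\<exists>t' a'. valid_config g t' a' \<and> (\<Sum>k<g. t' k) = (\<Sum>k<g. t k) \<and>
    config_matching g t' a' = config_matching g t a \<and>
    config_cost g t' (\<Sum>k<g. a' k) < config_cost g t (\<Sum>k<g. a k)"
proof (cases "transmission g t j \<le> transmission g t i")
  case True
  then show ?thesis using assms by (intro improve_config_directed[of g t a i j])
next
  case False
  then show ?thesis using assms by (intro improve_config_directed[of g t a j i]) auto
qed

text \<open>The bound 2 is the largest order of \<open>T_star 0 b\<close> with
  \<open>b \<le> 1\<close>. Having no larger branch at all is included.\<close>

definition concentrated :: "nat \<Rightarrow> (nat \<Rightarrow> nat) \<Rightarrow> bool" where
  "concentrated g t \<longleftrightarrow> (\<forall>i<g. \<forall>j<g. 2 < t i \<longrightarrow> 2 < t j \<longrightarrow> i = j)"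

text \<open>Descent on the cost, which drops strictly with every improvement. The last conjunct
  keeps track of this for the equality case.\<close>

lemma ex_concentrated_config:
  assumes "valid_config g t a"
  shows "\<exists>t' a'. valid_config g t' a' \<and> (\<Sum>k<g. t' k) = (\<Sum>k<g. t k) \<and>
    config_matching g t' a' = config_matching g t a \<and> concentrated g t' \<and>
    config_cost g t' (\<Sum>k<g. a' k) \<le> config_cost g t (\<Sum>k<g. a k) \<and>
    (\<not> concentrated g t \<longrightarrow> config_cost g t' (\<Sum>k<g. a' k) < config_cost g t (\<Sum>k<g. a k))"
  using assms
proof (induction "config_cost g t (\<Sum>k<g. a k)" arbitrary: t a rule: less_induct)
  case less
  show ?case
  proof (cases "concentrated g t")
    case False
    then obtain i j where "i < g" "j < g" "i \<noteq> j" "2 < t i" "2 < t j"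
      by (auto simp: concentrated_def)
    then obtain t' a' where ta: "valid_config g t' a'" "(\<Sum>k<g. t' k) = (\<Sum>k<g. t k)"
      "config_matching g t' a' = config_matching g t a"
      "config_cost g t' (\<Sum>k<g. a' k) < config_cost g t (\<Sum>k<g. a k)"
      using improve_config[OF less.prems] by blast
    show ?thesis
      using less.hyps[OF ta(4,1)] unfolding ta(2,3) using ta(4) False
      by (meson dual_order.strict_trans2 le_less_trans less_imp_le)
  qed (use less.prems in blast)
qed

section \<open>The graphs with branches of height at most two\<close>

lemma ex_bij_betw_fibres:
  assumes "finite A" "finite B"
    and card: "\<And>i. card {x \<in> A. k x = i} = card {y \<in> B. l y = i}"
  shows "\<exists>\<phi>. bij_betw \<phi> A B \<and> (\<forall>x\<in>A. l (\<phi> x) = k x)"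
proof -
  have "\<exists>\<psi>. bij_betw \<psi> {x \<in> A. k x = i} {y \<in> B. l y = i}" for i
    using finite_same_card_bij[OF _ _ card[of i]] assms(1,2) by simp
  then obtain \<psi> where \<psi>: "\<And>i. bij_betw (\<psi> i) {x \<in> A. k x = i} {y \<in> B. l y = i}" by metis
  let ?\<phi> = "\<lambda>x. \<psi> (k x) x"
  have key: "?\<phi> x \<in> B" "l (?\<phi> x) = k x" if "x \<in> A" for x
    using \<psi>[of "k x"] that by (auto simp: bij_betw_def)
  have "inj_on ?\<phi> A"
  proof (rule inj_onI)
    fix x y assume xy: "x \<in> A" "y \<in> A" "?\<phi> x = ?\<phi> y"
    then have "k x = k y" using key(2) by metis
    then show "x = y" using xy \<psi>[of "k x"] by (auto simp: bij_betw_def dest: inj_onD)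
  qed
  moreover have "y \<in> ?\<phi> ` A" if "y \<in> B" for y
  proof -
    have "y \<in> \<psi> (l y) ` {x \<in> A. k x = l y}" using \<psi>[of "l y"] that by (simp add: bij_betw_def)
    then show ?thesis by force
  qed
  ultimately have "bij_betw ?\<phi> A B" using key(1) by (auto simp: bij_betw_def)
  then show ?thesis using key(2) by blast
qed

lemma pair_iso_fun_graph:
  assumes "bij_betw \<phi> V W" "\<And>v. v \<in> V \<Longrightarrow> f v \<in> V" "\<And>v. v \<in> V \<Longrightarrow> \<phi> (f v) = f' (\<phi> v)"
  shows "pair_iso \<phi> (fun_graph V f) (fun_graph W f')"
proof -
  have W: "W = \<phi> ` V" and inj: "inj_on \<phi> V" using assms(1) by (auto simp: bij_betw_def)
  have "parcs (fun_graph W f') = map_prod \<phi> \<phi> ` parcs (fun_graph V f)"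
  proof (intro subset_antisym subsetI)
    fix e assume "e \<in> parcs (fun_graph W f')"
    then obtain v where "v \<in> V" "e = (\<phi> v, f' (\<phi> v)) \<or> e = (f' (\<phi> v), \<phi> v)"
      unfolding W by (cases e) auto
    then have "e = map_prod \<phi> \<phi> (v, f v) \<or> e = map_prod \<phi> \<phi> (f v, v)" "v \<in> V"
      using assms(3) by auto
    then show "e \<in> map_prod \<phi> \<phi> ` parcs (fun_graph V f)"
      by (elim disjE) (simp_all only:, auto intro!: imageI)
  next
    fix e assume "e \<in> map_prod \<phi> \<phi> ` parcs (fun_graph V f)"
    then show "e \<in> parcs (fun_graph W f')"
      unfolding W using assms(3) by auto
  qed
  then show ?thesis using inj W by (simp add: pair_iso_def)
qed

lemma (in spider_cycle) V_partition:
  "V = u ` {..<g} \<union> (tips \<union> (inner \<union> stubs))"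
  "u ` {..<g} \<inter> (tips \<union> (inner \<union> stubs)) = {}" "tips \<inter> (inner \<union> stubs) = {}"
  "inner \<inter> stubs = {}"
proof -
  have off: "off = tips \<union> (inner \<union> stubs)" by (auto simp: tips_def inner_def stubs_def)
  then show "V = u ` {..<g} \<union> (tips \<union> (inner \<union> stubs))" using V_eq by blast
  show "u ` {..<g} \<inter> (tips \<union> (inner \<union> stubs)) = {}"
    unfolding off[symmetric] using u_notin_off by blast
  show "tips \<inter> (inner \<union> stubs) = {}" "inner \<inter> stubs = {}"
    using tips_inner_disjoint by (auto simp: stubs_def)
qed

lemma (in spider_cycle) f_inner: "v \<in> inner \<Longrightarrow> f v = u (ix v)"
  using f_eq_u tips_inner_disjoint by (auto simp: inner_def tips_def)

text \<open>Inside each branch, inner vertices and stubs can be matched up arbitrarily, as their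
  numbers agree; for the stubs this is \<open>bsize_eq\<close>. The tips have to follow their
  parents.\<close>

lemma spider_cycle_iso:
  assumes "spider_cycle V f u g ix h" "spider_cycle V' f' u' g ix' h'"
    and bsize: "\<And>i. i < g \<Longrightarrow> rooted_cycle.bsize V ix i = rooted_cycle.bsize V' ix' i"
    and binner: "\<And>i. i < g \<Longrightarrow> rooted_cycle.binner V f u ix i = rooted_cycle.binner V' f' u' ix' i"
  shows "\<exists>\<phi>. pair_iso \<phi> (fun_graph V f) (fun_graph V' f')"
proof -
  interpret A: spider_cycle V f u g ix h by fact
  interpret B: spider_cycle V' f' u' g ix' h' by fact
  have off_ix: "v \<in> A.off \<Longrightarrow> ix v < g" "w \<in> B.off \<Longrightarrow> ix' w < g" for v w
    using A.offD(5) B.offD(5) by auto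
  have "card {v \<in> A.inner. ix v = i} = card {v \<in> B.inner. ix' v = i}" for i
  proof (cases "i < g")
    case True
    then show ?thesis using binner by (simp add: A.binner_def B.binner_def)
  next
    case False
    then have "{v \<in> A.inner. ix v = i} = {}" "{v \<in> B.inner. ix' v = i} = {}"
      using off_ix by (auto simp: A.inner_def B.inner_def)
    then show ?thesis by (simp only: card.empty)
  qed
  then obtain \<alpha> where \<alpha>: "bij_betw \<alpha> A.inner B.inner" "\<And>v. v \<in> A.inner \<Longrightarrow> ix' (\<alpha> v) = ix v"
    using ex_bij_betw_fibres[OF A.finite_inner B.finite_inner, of ix ix'] by auto
  have fin: "finite A.stubs" "finite B.stubs"
    using A.finite_off B.finite_off by (auto simp: A.stubs_def B.stubs_def)
  have "card {v \<in> A.stubs. ix v = i} = card {v \<in> B.stubs. ix' v = i}" for i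
  proof (cases "i < g")
    case True
    then show ?thesis using binner[OF True] bsize[OF True] A.bsize_eq[OF True] B.bsize_eq[OF True] by simp
  next
    case False
    then have "{v \<in> A.stubs. ix v = i} = {}" "{v \<in> B.stubs. ix' v = i} = {}"
      using off_ix by (auto simp: A.stubs_def B.stubs_def)
    then show ?thesis by (simp only: card.empty)
  qed
  then obtain \<beta> where \<beta>: "bij_betw \<beta> A.stubs B.stubs" "\<And>v. v \<in> A.stubs \<Longrightarrow> ix' (\<beta> v) = ix v"
    using ex_bij_betw_fibres[OF fin, of ix ix'] by auto
  have fA: "bij_betw f A.tips A.inner" and fB: "bij_betw f' B.tips B.inner"
    using A.inj_on_f_tips A.f_tips B.inj_on_f_tips B.f_tips by (auto simp: bij_betw_def)
  \<comment> \<open>A tip goes to the unique tip below the image of its parent, so the map commutes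
    with \<open>f\<close> by construction.\<close>
  define \<gamma> where "\<gamma> = inv_into B.tips f' \<circ> (\<alpha> \<circ> f)"
  have \<gamma>: "bij_betw \<gamma> A.tips B.tips"
    unfolding \<gamma>_def using fA \<alpha>(1) bij_betw_inv_into[OF fB] by (metis bij_betw_trans)
  have f_\<gamma>: "f' (\<gamma> v) = \<alpha> (f v)" if "v \<in> A.tips" for v
  proof -
    have "\<alpha> (f v) \<in> B.inner" using that fA \<alpha>(1) by (meson bij_betwE)
    then show ?thesis unfolding \<gamma>_def using B.f_tips by (simp add: f_inv_into_f)
  qed
  have \<delta>: "bij_betw (\<lambda>v. u' (ix v)) (u ` {..<g}) (u' ` {..<g})"
  proof (rule bij_betw_byWitness[where f' = "\<lambda>v. u (ix' v)"])
  qed (auto simp: A.ix_u B.ix_u)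
  define \<phi> where "\<phi> v = (if v \<in> A.inner then \<alpha> v else if v \<in> A.stubs then \<beta> v
    else if v \<in> A.tips then \<gamma> v else u' (ix v))" for v
  have \<phi>_inner: "\<phi> v = \<alpha> v" if "v \<in> A.inner" for v using that by (simp add: \<phi>_def)
  have \<phi>_stubs: "\<phi> v = \<beta> v" if "v \<in> A.stubs" for v using that A.V_partition by (auto simp: \<phi>_def)
  have \<phi>_tips: "\<phi> v = \<gamma> v" if "v \<in> A.tips" for v using that A.V_partition by (auto simp: \<phi>_def)
  have \<phi>_u: "\<phi> (u i) = u' i" if "i < g" for i
  proof -
    have "u i \<notin> A.inner" "u i \<notin> A.stubs" "u i \<notin> A.tips"
      using A.u_notin_off[OF that] by (auto simp: A.inner_def A.stubs_def A.tips_def)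
    then show ?thesis using that by (simp add: \<phi>_def A.ix_u)
  qed
  have "bij_betw \<phi> (u ` {..<g} \<union> (A.tips \<union> (A.inner \<union> A.stubs)))
      (u' ` {..<g} \<union> (B.tips \<union> (B.inner \<union> B.stubs)))"
  proof (intro bij_betw_combine)
    show "bij_betw \<phi> (u ` {..<g}) (u' ` {..<g})"
      using \<delta> by (rule bij_betw_cong[THEN iffD1, rotated]) (auto simp: \<phi>_u A.ix_u)
    show "bij_betw \<phi> A.tips B.tips"
      using \<gamma> by (rule bij_betw_cong[THEN iffD1, rotated]) (simp add: \<phi>_tips)
    show "bij_betw \<phi> A.inner B.inner"
      using \<alpha>(1) by (rule bij_betw_cong[THEN iffD1, rotated]) (simp add: \<phi>_inner)
    show "bij_betw \<phi> A.stubs B.stubs"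
      using \<beta>(1) by (rule bij_betw_cong[THEN iffD1, rotated]) (simp add: \<phi>_stubs)
  qed (rule B.V_partition)+
  then have bij: "bij_betw \<phi> V V'"
    by (simp only: A.V_partition(1)[symmetric] B.V_partition(1)[symmetric])
  have "\<phi> (f v) = f' (\<phi> v)" if "v \<in> V" for v
  proof -
    have "v \<in> u ` {..<g} \<union> (A.tips \<union> (A.inner \<union> A.stubs))" using that A.V_partition(1) by blast
    then consider i where "v = u i" "i < g" | "v \<in> A.tips" | "v \<in> A.inner" | "v \<in> A.stubs" by blast
    then show ?thesis
    proof cases
      case (1 i)
      then show ?thesis using \<phi>_u A.f_u B.f_u A.Suc_mod_less by simp
    next
      case 2
      then have "f v \<in> A.inner" using A.f_tips by blast
      then show ?thesis using 2 by (simp add: \<phi>_tips \<phi>_inner f_\<gamma>)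
    next
      case 3
      then have "\<alpha> v \<in> B.inner" "ix v < g" using \<alpha>(1) off_ix by (auto simp: A.inner_def dest: bij_betwE)
      then show ?thesis using 3 \<alpha>(2)
        by (simp add: \<phi>_inner A.f_inner B.f_inner \<phi>_u)
    next
      case 4
      then have "\<beta> v \<in> B.stubs" "ix v < g" using \<beta>(1) off_ix by (auto simp: A.stubs_def dest: bij_betwE)
      then show ?thesis using 4 \<beta>(2)
        by (simp add: \<phi>_stubs A.f_stub B.f_stub \<phi>_u)
    qed
  qed
  then show ?thesis using pair_iso_fun_graph[OF bij] A.f_in by blast
qed

text \<open>Branch \<open>k\<close> becomes branch 0, since the large branch has to come first.
  \<open>f\<close> and \<open>h\<close> are kept, hence so are \<open>off\<close>,
  \<open>inner\<close> and \<open>below\<close>.\<close>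

lemma (in spider_cycle) rotate:
  assumes k: "k < g"
  defines "u' \<equiv> \<lambda>i. u ((i + k) mod g)" and "ix' \<equiv> \<lambda>v. (ix v + (g - k)) mod g"
  shows "spider_cycle V f u' g ix' h"
    and "i < g \<Longrightarrow> rooted_cycle.bsize V ix' i = bsize ((i + k) mod g)"
proof -
  have ix_iff: "ix' v = i \<longleftrightarrow> ix v = (i + k) mod g" if "v \<in> V" "i < g" for v i
  proof -
    have "((j + (g - k)) mod g = i) = (j = (i + k) mod g)" if "j < g" for j
      using that \<open>i < g\<close> k by (auto simp: mod_if split: if_splits)
    then show ?thesis using ix_less[OF that(1)] by (simp add: ix'_def)
  qed
  have less: "(i + k) mod g < g" "ix' v < g" for i v using g3 by (simp_all add: ix'_def)
  have u': "u' (ix' v) = u (ix v)" if "v \<in> V" for v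
    using ix_iff[OF that, of "ix' v"] less by (simp add: u'_def)
  interpret R: rooted_cycle V f u' g ix' h
  proof
    fix i assume i: "i < g"
    show "u' i \<in> V" using u_in less by (simp add: u'_def)
    then show "ix' (u' i) = i" using ix_iff i less ix_u by (simp add: u'_def)
    have "Suc ((i + k) mod g) mod g = (Suc i mod g + k) mod g" by (simp add: mod_simps)
    then show "f (u' i) = u' (Suc i mod g)" using f_u less by (simp add: u'_def)
  next
    fix v assume v: "v \<in> V" "v \<noteq> u' (ix' v)"
    then show "f v \<in> V \<and> ix' (f v) = ix' v \<and> h (f v) < h v"
      using f_off[of v] u' by (simp add: ix'_def)
  qed (use fin g3 less in auto)
  have off: "R.off = off" using u' by (auto simp: R.off_def off_def)
  then have inner: "R.inner = inner" by (simp add: R.inner_def inner_def)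
  have "R.below v = below v" for v
    by (simp add: R.below_def below_def R.anc_def anc_def off)
  then show "spider_cycle V f u' g ix' h"
    by unfold_locales (use below_inner inner in simp)
  show "R.bsize i = bsize ((i + k) mod g)" if "i < g"
  proof -
    have "{x \<in> V. ix' x = i} = {x \<in> V. ix x = (i + k) mod g}" using ix_iff that by blast
    then show ?thesis by (simp add: R.bsize_def bsize_def)
  qed
qed

section \<open>The graphs built from trees \<open>T_star\<close> as functional graphs\<close>

definition U_star :: "nat \<Rightarrow> (nat \<Rightarrow> nat) \<Rightarrow> (nat \<Rightarrow> nat) \<Rightarrow> (nat \<times> nat) pair_pre_digraph" where
  "U_star g a b = U_graph (map (\<lambda>i. T_star (a i) (b i)) [0..<g])"

definition U_verts :: "nat \<Rightarrow> (nat \<Rightarrow> nat) \<Rightarrow> (nat \<Rightarrow> nat) \<Rightarrow> (nat \<times> nat) set" where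
  "U_verts g a b = {(i, v). i < g \<and> v \<le> 2 * a i + b i}"

text \<open>Follows the numbering of \<open>T_star\<close>: neighbours of the root go to the root,
  the outer vertex \<open>a i + b i + v\<close> goes to \<open>v\<close>, and each root goes to the
  next root.\<close>

definition U_fun :: "nat \<Rightarrow> (nat \<Rightarrow> nat) \<Rightarrow> (nat \<Rightarrow> nat) \<Rightarrow> nat \<times> nat \<Rightarrow> nat \<times> nat" where
  "U_fun g a b = (\<lambda>(i, v). if v = 0 then (Suc i mod g, 0)
     else if v \<le> a i + b i then (i, 0) else (i, v - (a i + b i)))"

lemma symcl_iff: "(x, y) \<in> symcl R \<longleftrightarrow> (x, y) \<in> R \<or> (y, x) \<in> R"
  by (auto simp: symcl_def)

lemma U_star_eq_fun_graph:
  assumes "0 < g"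
  shows "U_star g a b = fun_graph (U_verts g a b) (U_fun g a b)"
proof -
  let ?E = "\<lambda>i v w. v = 0 \<and> 1 \<le> w \<and> w \<le> a i + b i \<or> 1 \<le> v \<and> v \<le> a i \<and> w = a i + b i + v"
  have verts: "pverts (U_star g a b) = U_verts g a b"
    by (auto simp: U_star_def U_graph_def T_star_def U_verts_def)
  have star: "(v, w) \<in> parcs (fst (T_star (a i) (b i))) \<longleftrightarrow> ?E i v w \<or> ?E i w v" for i v w
    by (auto simp: T_star_def symcl_iff)
  have U: "((i, v), (j, w)) \<in> parcs (U_star g a b) \<longleftrightarrow>
      i < g \<and> i = j \<and> (?E i v w \<or> ?E i w v) \<or>
      v = 0 \<and> w = 0 \<and> (i < g \<and> j = Suc i mod g \<or> j < g \<and> i = Suc j mod g)" for i v j w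
  proof -
    have "((i, v), (j, w)) \<in> parcs (U_star g a b) \<longleftrightarrow>
      i < g \<and> i = j \<and> (v, w) \<in> parcs (fst (T_star (a i) (b i))) \<or>
      ((i, v), (j, w)) \<in> symcl {((i, 0), (j, 0)) | i j. i < g \<and> j = Suc i mod g}"
    proof -
      have "{((i, snd (map (\<lambda>i. T_star (a i) (b i)) [0..<g] ! i)),
          (j, snd (map (\<lambda>i. T_star (a i) (b i)) [0..<g] ! j))) | i j. i < g \<and> j = Suc i mod g} =
          {((i, 0), (j, 0)) | i j. i < g \<and> j = Suc i mod g}"
        using assms by (intro Collect_cong) (auto simp: T_star_def)
      then show ?thesis by (auto simp: U_star_def U_graph_def)
    qed
    then show ?thesis unfolding star symcl_iff by auto
  qed
  have F: "(i, v) \<in> U_verts g a b \<and> (j, w) = U_fun g a b (i, v) \<longleftrightarrow>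
      i < g \<and> i = j \<and> ?E i w v \<or> v = 0 \<and> w = 0 \<and> i < g \<and> j = Suc i mod g" for i v j w
  proof -
    consider "v = 0" | "0 < v" "v \<le> a i + b i" | "a i + b i < v" by linarith
    then show ?thesis by cases (auto simp: U_verts_def U_fun_def)
  qed
  have "(p, q) \<in> parcs (U_star g a b) \<longleftrightarrow> (p, q) \<in> parcs (fun_graph (U_verts g a b) (U_fun g a b))" for p q
  proof (cases p; cases q)
    fix i v j w assume pq: "p = (i, v)" "q = (j, w)"
    show ?thesis
      unfolding pq fun_graph_simps F U by auto
  qed
  then have "parcs (U_star g a b) = parcs (fun_graph (U_verts g a b) (U_fun g a b))" by auto
  then show ?thesis using verts by (simp add: fun_graph_def)
qed

lemma U_star_spider:
  fixes a b :: "nat \<Rightarrow> nat"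
  assumes g: "3 \<le> g"
  defines "h \<equiv> \<lambda>(i, v). if v = 0 then 0 else if v \<le> a i + b i then 1 else (2::nat)"
  shows "spider_cycle (U_verts g a b) (U_fun g a b) (\<lambda>i. (i, 0)) g fst h"
    and "i < g \<Longrightarrow> rooted_cycle.bsize (U_verts g a b) fst i = 2 * a i + b i + 1"
    and "i < g \<Longrightarrow> rooted_cycle.binner (U_verts g a b) (U_fun g a b) (\<lambda>i. (i, 0)) fst i = a i"
proof -
  let ?V = "U_verts g a b" and ?f = "U_fun g a b"
  interpret R: rooted_cycle ?V ?f "\<lambda>i. (i, 0)" g fst h
  proof
    show "finite ?V"
      by (rule finite_subset[of _ "SIGMA i:{..<g}. {..2 * a i + b i}"]) (auto simp: U_verts_def)
    show "?f (i, 0) = (Suc i mod g, 0)" for i by (simp add: U_fun_def)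
    fix v assume "v \<in> ?V" "v \<noteq> (fst v, 0)"
    then show "?f v \<in> ?V \<and> fst (?f v) = fst v \<and> h (?f v) < h v"
      by (cases v) (auto simp: U_verts_def U_fun_def h_def)
  qed (use g in \<open>auto simp: U_verts_def\<close>)
  have off: "(i, v) \<in> R.off \<longleftrightarrow> i < g \<and> 0 < v \<and> v \<le> 2 * a i + b i" for i v
  proof -
    have "(i, v) \<in> ?V \<longleftrightarrow> i < g \<and> v \<le> 2 * a i + b i" by (simp add: U_verts_def)
    then show ?thesis by (auto simp: R.off_def)
  qed
  have inner: "(i, v) \<in> R.inner \<longleftrightarrow> i < g \<and> 0 < v \<and> v \<le> a i" for i v
  proof
    assume "(i, v) \<in> R.inner"
    then obtain j w where w: "(j, w) \<in> R.off" "?f (j, w) = (i, v)" "(i, v) \<in> R.off"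
      by (auto simp: R.inner_def)
    then show "i < g \<and> 0 < v \<and> v \<le> a i"
      by (auto simp: off U_fun_def split: if_splits)
  next
    assume v: "i < g \<and> 0 < v \<and> v \<le> a i"
    then have "?f (i, a i + b i + v) = (i, v)" "(i, a i + b i + v) \<in> R.off" "(i, v) \<in> R.off"
      by (auto simp: off U_fun_def)
    then show "(i, v) \<in> R.inner" unfolding R.inner_def by blast
  qed
  have anc_root: "R.anc (i, 0) = {}" if "i < g" for i using R.anc_u[OF that] .
  have anc_low: "R.anc (i, v) = {(i, v)}" if "i < g" "0 < v" "v \<le> a i + b i" for i v
    using R.anc_step[of "(i, v)"] anc_root that by (simp add: off U_fun_def)
  have anc_high: "R.anc (i, v) = {(i, v), (i, v - (a i + b i))}"
    if "i < g" "a i + b i < v" "v \<le> 2 * a i + b i" for i v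
  proof -
    have "R.anc (i, v - (a i + b i)) = {(i, v - (a i + b i))}"
      using that by (intro anc_low) auto
    then show ?thesis using R.anc_step[of "(i, v)"] that by (simp add: off U_fun_def)
  qed
  have "{x \<in> ?V. (i, v) \<in> R.anc x} = {(i, v), (i, a i + b i + v)}" if "(i, v) \<in> R.inner" for i v
  proof (intro subset_antisym subsetI)
    have v: "i < g" "0 < v" "v \<le> a i" using that inner by auto
    fix x assume "x \<in> {(i, v), (i, a i + b i + v)}"
    then show "x \<in> {x \<in> ?V. (i, v) \<in> R.anc x}"
      using anc_low[of i v] anc_high[of i "a i + b i + v"] v by (auto simp: U_verts_def)
  next
    have v: "i < g" "0 < v" "v \<le> a i" using that inner by auto
    fix x assume x: "x \<in> {x \<in> ?V. (i, v) \<in> R.anc x}"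
    obtain j w where jw: "x = (j, w)" by (cases x)
    have "j < g" "w \<le> 2 * a j + b j" using x jw by (auto simp: U_verts_def)
    then show "x \<in> {(i, v), (i, a i + b i + v)}"
      using x v anc_root[of j] anc_low[of j w] anc_high[of j w] unfolding jw
      by (cases "w = 0"; cases "w \<le> a j + b j") auto
  qed
  then have "R.below x = 2" if "x \<in> R.inner" for x
    using that inner by (cases x) (auto simp: R.below_def card_insert_if)
  then show "spider_cycle ?V ?f (\<lambda>i. (i, 0)) g fst h" by unfold_locales
  show "R.bsize i = 2 * a i + b i + 1" if "i < g"
  proof -
    have "{x \<in> ?V. fst x = i} = Pair i ` {..2 * a i + b i}"
      using that by (auto simp: U_verts_def)
    then show ?thesis by (simp add: R.bsize_def card_image inj_on_def)
  qed
  show "R.binner i = a i" if "i < g"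
  proof -
    have "{x \<in> R.inner. fst x = i} = Pair i ` {1..a i}"
      using that inner by auto
    then show ?thesis by (simp add: R.binner_def card_image inj_on_def)
  qed
qed

section \<open>The extremal graphs\<close>

abbreviation extremal_graph :: "nat \<Rightarrow> nat \<Rightarrow> (nat \<Rightarrow> nat) \<Rightarrow> (nat \<times> nat) pair_pre_digraph" where
  "extremal_graph g a b \<equiv> U_graph (T_star a (b 1) # map (\<lambda>j. T_star 0 (b j)) [2..<Suc g])"

lemma (in spider_cycle) valid_config_bsize_binner: "valid_config g bsize binner"
  using bsize_eq by (simp add: valid_config_def)

text \<open>After a rotation only branch 0 can have order above 2. Each of the others has no path
  and at most one pendant edge, so it is \<open>T_star 0 b\<close> with
  \<open>b \<le> 1\<close>.\<close>

lemma (in spider_cycle) ex_extremal_iso: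
  assumes "concentrated g bsize"
  obtains a b \<phi> where "\<forall>j\<in>{2..g}. b j \<le> 1" "unicyclic (extremal_graph g a b)"
    "girth (extremal_graph g a b) = g" "pair_iso \<phi> G (extremal_graph g a b)"
proof -
  obtain k where k: "k < g" "\<And>i. i < g \<Longrightarrow> i \<noteq> k \<Longrightarrow> bsize i \<le> 2"
  proof (cases "\<exists>k<g. 2 < bsize k")
    case True
    then obtain k where "k < g" "2 < bsize k" by blast
    then show thesis using that[of k] assms unfolding concentrated_def by (meson not_le)
  next
    case False
    then have "bsize i \<le> 2" if "i < g" for i using that by (meson not_le)
    then show thesis using that[of 0] g3 by simp
  qed
  let ?u = "\<lambda>i. u ((i + k) mod g)" and ?ix = "\<lambda>v. (ix v + (g - k)) mod g"
  interpret R: spider_cycle V f ?u g ?ix h by (rule rotate(1)[OF k(1)])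
  have small: "R.bsize i \<le> 2" if "i < g" "i \<noteq> 0" for i
  proof -
    have "(i + k) mod g \<noteq> k" using that k(1) by (auto simp: mod_if split: if_splits)
    then show ?thesis unfolding rotate(2)[OF k(1) that(1)] using k(2) g3 by simp
  qed
  have binner_0: "R.binner i = 0" if "i < g" "i \<noteq> 0" for i
    using small[OF that] R.bsize_eq[OF that(1)] by simp
  \<comment> \<open>The number of stubs. Branches are numbered from 1 in \<open>b\<close> but from 0
    in the locale, whence the shift.\<close>
  define b where "b j = R.bsize (j - 1) - 1 - 2 * R.binner (j - 1)" for j
  let ?b = "\<lambda>i. b (Suc i)" and ?a = "R.binner"
  have "T_star (R.binner 0) (b 1) # map (\<lambda>j. T_star 0 (b j)) [2..<Suc g] =
    map (\<lambda>i. T_star (?a i) (?b i)) [0..<g]"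
  proof (rule nth_equalityI)
    show "length (T_star (R.binner 0) (b 1) # map (\<lambda>j. T_star 0 (b j)) [2..<Suc g]) =
      length (map (\<lambda>i. T_star (?a i) (?b i)) [0..<g])" using g3 by simp
    fix i assume "i < length (T_star (R.binner 0) (b 1) # map (\<lambda>j. T_star 0 (b j)) [2..<Suc g])"
    then have i: "i < g" using g3 by simp
    show "(T_star (R.binner 0) (b 1) # map (\<lambda>j. T_star 0 (b j)) [2..<Suc g]) ! i =
      map (\<lambda>i. T_star (?a i) (?b i)) [0..<g] ! i"
    proof (cases i)
      case (Suc k)
      then have "[2..<Suc g] ! k = Suc i" using i by (subst nth_upt) auto
      then show ?thesis using Suc i binner_0[of i] by (simp del: upt_Suc)
    qed (use i in simp)
  qed
  then have U: "extremal_graph g (R.binner 0) b = U_star g ?a ?b"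
    by (simp only: U_star_def)
  also have "\<dots> = fun_graph (U_verts g ?a ?b) (U_fun g ?a ?b)"
    using g3 by (intro U_star_eq_fun_graph) simp
  finally have U: "extremal_graph g (R.binner 0) b = fun_graph (U_verts g ?a ?b) (U_fun g ?a ?b)" .
  note spider = U_star_spider[OF g3, where a = ?a and b = ?b]
  interpret E: spider_cycle "U_verts g ?a ?b" "U_fun g ?a ?b" "\<lambda>i. (i, 0)" g fst
    "\<lambda>(i, v). if v = 0 then 0 else if v \<le> ?a i + ?b i then 1 else (2::nat)"
    by (rule spider(1))
  have "\<exists>\<phi>. pair_iso \<phi> G E.G"
  proof (rule spider_cycle_iso[OF R.spider_cycle_axioms E.spider_cycle_axioms])
    fix i assume i: "i < g"
    show "R.binner i = E.binner i" using spider(3)[OF i] by simp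
    show "R.bsize i = E.bsize i"
      using spider(2)[OF i] R.bsize_eq[OF i] by (simp add: b_def)
  qed
  then obtain \<phi> where "pair_iso \<phi> G (extremal_graph g (R.binner 0) b)" unfolding U by blast
  moreover have "\<forall>j\<in>{2..g}. b j \<le> 1"
  proof
    fix j assume "j \<in> {2..g}"
    then have "j - 1 < g" "j - 1 \<noteq> 0" by auto
    then show "b j \<le> 1" using small[of "j - 1"] by (simp add: b_def)
  qed
  moreover have "unicyclic (extremal_graph g (R.binner 0) b)"
    "girth (extremal_graph g (R.binner 0) b) = g"
    unfolding U by (rule E.unicyclic, rule E.girth_eq)
  ultimately show thesis using that by blast
qed

text \<open>Turns the outcome of the numerical descent back into a graph; by validity the number
  \<open>t i - 1 - 2 * a i\<close> of pendant edges is not truncated.\<close>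

lemma ex_spider_of_config:
  assumes "3 \<le> g" "valid_config g t a" "concentrated g t"
  obtains V :: "(nat \<times> nat) set" and f u ix h where "spider_cycle V f u g ix h"
    "concentrated g (rooted_cycle.bsize V ix)" "card V = (\<Sum>i<g. t i)"
    "2 * wiener_index (fun_graph V f) = config_cost g t (\<Sum>i<g. a i)"
    "matching_number (fun_graph V f) = config_matching g t a"
proof -
  define b where "b i = t i - 1 - 2 * a i" for i
  note spider = U_star_spider[OF assms(1), where a = a and b = b]
  interpret E: spider_cycle "U_verts g a b" "U_fun g a b" "\<lambda>i. (i, 0)" g fst
    "\<lambda>(i, v). if v = 0 then 0 else if v \<le> a i + b i then 1 else (2::nat)"
    by (rule spider(1))
  have t: "E.bsize i = t i" if "i < g" for i
  proof -
    have "2 * a i < t i" using assms(2) that by (simp add: valid_config_def)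
    then show ?thesis using spider(2)[OF that] by (simp add: b_def)
  qed
  have a: "E.binner i = a i" if "i < g" for i using spider(3)[OF that] .
  have sums: "(\<Sum>i<g. E.bsize i) = (\<Sum>i<g. t i)" "(\<Sum>i<g. E.binner i) = (\<Sum>i<g. a i)"
    using t a by auto
  have "concentrated g E.bsize"
    using assms(3) t by (simp add: concentrated_def)
  moreover have "card (U_verts g a b) = (\<Sum>i<g. t i)"
    using E.sum_bsize sums by simp
  moreover have "config_cost g E.bsize N = config_cost g t N" for N
    unfolding config_cost_def sums using t by simp
  then have "2 * wiener_index E.G = config_cost g t (\<Sum>i<g. a i)"
    using E.double_wiener_eq_config sums by simp
  moreover have "matching_number E.G = config_matching g t a"
    using E.matching_number_eq_config config_matching_cong[of g E.bsize t E.binner a] t a by simp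
  ultimately show thesis using that[OF spider(1)] by blast
qed

text \<open>The orders of the branches are kept at first. If some inner edge has more than two
  vertices beyond it, reshaping the branches is already strict: the intermediate value argument
  picks at most \<open>card inner\<close> paths with the right matching number. Otherwise strictness
  comes from the concentration.\<close>

lemma (in rooted_cycle) ex_better_config:
  assumes "\<not> (spider_cycle V f u g ix h \<and> concentrated g bsize)"
  obtains t a where "valid_config g t a" "concentrated g t" "(\<Sum>i<g. t i) = card V"
    "config_matching g t a = matching_number G"
    "config_cost g t (\<Sum>i<g. a i) < 2 * wiener_index G"
proof -
  have "\<exists>a. valid_config g bsize a \<and> config_matching g bsize a = matching_number G \<and>
    (config_cost g bsize (\<Sum>i<g. a i) < 2 * wiener_index G \<or>
     config_cost g bsize (\<Sum>i<g. a i) = 2 * wiener_index G \<and> \<not> concentrated g bsize)"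
  proof (cases "\<forall>v\<in>inner. below v = 2")
    case True
    then interpret S: spider_cycle V f u g ix h by unfold_locales simp
    have "\<not> concentrated g bsize" using assms S.spider_cycle_axioms by blast
    then show ?thesis
      using S.valid_config_bsize_binner S.matching_number_eq_config S.double_wiener_eq_config
      by (intro exI[of _ binner]) simp
  next
    case False
    obtain c where c: "\<And>i. i < g \<Longrightarrow> c i \<le> binner i" "\<And>i. i < g \<Longrightarrow> 2 * c i < bsize i"
      "matching_number G \<le> config_matching g bsize c"
      using matching_number_le_config by metis
    obtain a where a: "\<And>i. i < g \<Longrightarrow> a i \<le> c i" "config_matching g bsize a = matching_number G"
      using config_matching_IVT[OF config_matching_0_le c(3)] by blast
    have "valid_config g bsize a"
      unfolding valid_config_def using a(1) c(2) by (meson le_less_trans mult_le_mono2)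
    moreover have "(\<Sum>i<g. a i) \<le> card inner"
      unfolding sum_binner[symmetric] using a(1) c(1) by (intro sum_mono) (meson le_trans lessThan_iff)
    then have "config_cost g bsize (\<Sum>i<g. a i) < 2 * wiener_index G"
      using config_cost_mono[of "\<Sum>i<g. a i" "card inner" g bsize] double_wiener_gt_cost False
      by (meson le_less_trans)
    ultimately show ?thesis using a(2) by blast
  qed
  then obtain a where a: "valid_config g bsize a" "config_matching g bsize a = matching_number G"
    "config_cost g bsize (\<Sum>i<g. a i) < 2 * wiener_index G \<or>
     config_cost g bsize (\<Sum>i<g. a i) = 2 * wiener_index G \<and> \<not> concentrated g bsize"
    by blast
  obtain t' a' where ta: "valid_config g t' a'" "(\<Sum>k<g. t' k) = (\<Sum>k<g. bsize k)"
    "config_matching g t' a' = config_matching g bsize a" "concentrated g t'"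
    "config_cost g t' (\<Sum>k<g. a' k) \<le> config_cost g bsize (\<Sum>k<g. a k)"
    "\<not> concentrated g bsize \<Longrightarrow> config_cost g t' (\<Sum>k<g. a' k) < config_cost g bsize (\<Sum>k<g. a k)"
    using ex_concentrated_config[OF a(1)] by blast
  have "config_cost g t' (\<Sum>k<g. a' k) < 2 * wiener_index G"
    using a(3) ta(5,6) by linarith
  then show thesis using that ta(1-4) a(2) sum_bsize by simp
qed

theorem theorem2p11:
  fixes G :: "'a pair_pre_digraph" and n g :: nat
  assumes "unicyclic G"
    and "card (pverts G) = n"
    and "girth G = g"
  shows "\<exists>(a\<^sub>1 :: nat) (b :: nat \<Rightarrow> nat).
    (\<forall>j\<in>{2..g}. b j \<le> 1) \<and>
    (let G' = U_graph (T_star a\<^sub>1 (b 1) # map (\<lambda>j. T_star 0 (b j)) [2..<Suc g]) in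
      unicyclic G' \<and> card (pverts G') = n \<and> girth G' = g \<and>
      matching_number G' = matching_number G \<and>
      wiener_index G \<ge> wiener_index G' \<and>
      (wiener_index G = wiener_index G' \<longleftrightarrow> digraph_iso (with_proj G) (with_proj G')))"
proof -
  interpret G: pair_graph G using assms(1) by (simp add: unicyclic_def)
  obtain f u ix h where R: "rooted_cycle (pverts G) f u g ix h" and G: "G = fun_graph (pverts G) f"
    using unicyclic_imp_rooted_cycle[OF assms(1,3)] .
  interpret R: rooted_cycle "pverts G" f u g ix h by (rule R)
  have card_iso: "card (pverts H') = card (pverts H)"
    if "pair_iso \<phi> H H'" for \<phi> :: "'c \<Rightarrow> 'd" and H H'
    using that by (auto simp: pair_iso_def card_image)
  show ?thesis
  proof (cases "spider_cycle (pverts G) f u g ix h \<and> concentrated g R.bsize")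
    case True
    then interpret S: spider_cycle "pverts G" f u g ix h by simp
    obtain a b \<phi> where E: "\<forall>j\<in>{2..g}. b j \<le> 1" "unicyclic (extremal_graph g a b)"
      "girth (extremal_graph g a b) = g" and iso: "pair_iso \<phi> G (extremal_graph g a b)"
      using S.ex_extremal_iso True unfolding G[symmetric] by metis
    have "pair_graph (extremal_graph g a b)" using E(2) by (simp add: unicyclic_def)
    then have "wiener_index (extremal_graph g a b) = wiener_index G"
      using wiener_index_pair_iso[OF G.pair_graph _ iso] by simp
    moreover have "matching_number (extremal_graph g a b) = matching_number G"
      using matching_number_pair_iso[OF G.pair_graph iso] .
    \<comment> \<open>Here both sides of the equivalence hold; in the other case both fail.\<close>
    moreover have "digraph_iso (with_proj G) (with_proj (extremal_graph g a b))"
      using iso G.digraph_iso_with_proj_iff by blast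
    ultimately show ?thesis
      using E card_iso[OF iso] assms(2)
      by (intro exI[of _ a] exI[of _ b]) (simp only: Let_def, simp)
  next
    case False
    then obtain t a where ta: "valid_config g t a" "concentrated g t" "(\<Sum>i<g. t i) = n"
      "config_matching g t a = matching_number G"
      "config_cost g t (\<Sum>i<g. a i) < 2 * wiener_index G"
      using R.ex_better_config assms(2) unfolding G[symmetric] by metis
    obtain V :: "(nat \<times> nat) set" and f' u' ix' h' where S: "spider_cycle V f' u' g ix' h'"
      "concentrated g (rooted_cycle.bsize V ix')" "card V = n"
      "2 * wiener_index (fun_graph V f') < 2 * wiener_index G"
      "matching_number (fun_graph V f') = matching_number G"
      using ex_spider_of_config[OF R.g3 ta(1,2)] ta(3-5) by metis
    interpret S: spider_cycle V f' u' g ix' h' by (rule S(1))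
    obtain a b \<phi> where E: "\<forall>j\<in>{2..g}. b j \<le> 1" "unicyclic (extremal_graph g a b)"
      "girth (extremal_graph g a b) = g" and iso: "pair_iso \<phi> S.G (extremal_graph g a b)"
      using S.ex_extremal_iso[OF S(2)] .
    have pg: "pair_graph (extremal_graph g a b)" using E(2) by (simp add: unicyclic_def)
    have W: "wiener_index (extremal_graph g a b) < wiener_index G"
      using wiener_index_pair_iso[OF S.pair_graph pg iso] S(4) by simp
    moreover have "matching_number (extremal_graph g a b) = matching_number G"
      using matching_number_pair_iso[OF S.pair_graph iso] S(5) by simp
    moreover have "\<not> digraph_iso (with_proj G) (with_proj (extremal_graph g a b))"
    proof
      assume "digraph_iso (with_proj G) (with_proj (extremal_graph g a b))"
      then obtain \<psi> where "pair_iso \<psi> G (extremal_graph g a b)"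
        using G.digraph_iso_with_proj_iff by blast
      then show False using wiener_index_pair_iso[OF G.pair_graph pg] W by fastforce
    qed
    ultimately show ?thesis
      using E card_iso[OF iso] S(3)
      by (intro exI[of _ a] exI[of _ b]) (simp only: Let_def, simp)
  qed
qed

end
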